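(* The family $\{\Sigma_w\}_{w\in Y^*}$ of elements of $\mathbf{k}\langle Y\rangle$ dual to the basis $\{\Pi_w\}_{w\in Y^*}$ satisfies the following. (1) $\Sigma_{1_{Y^*}}=1$. (2) For any $w=l_1^{i_1}\cdots l_k^{i_k}$ with $l_1,\dots,l_k$ Lyndon words, $l_1>\cdots>l_k$ and $i_1,\dots,i_k\ge 1$, $$\Sigma_w=\frac{\Sigma_{l_1}^{\star i_1}\star\cdots\star\Sigma_{l_k}^{\star i_k}}{i_1!\cdots i_k!},$$ where $\star$ is the $q$-stuffle product and $\Sigma^{\star i}$ denotes the $i$-th power for $\star$. (3) For any letter $y\in Y$, $\Sigma_y=y=\check\pi_1(y)$.
   Context: Let $\mathbf{k}$ be a commutative unital $\mathbb{Q}$-algebra and $q\in\mathbf{k}$. Let $Y=\{y_s\}_{s\ge1}$ be an alphabet totally ordered by $y_1>y_2>\cdots$; $Y^*$ is the set of words, ordered lexicographically (a proper prefix being smaller), $1_{Y^*}$ the empty word (the unit, also written $1$), $Y^+=Y^*\setminus\{1_{Y^*}\}$, $\mathbf{k}\langle Y\rangle$ the noncommutative polynomials. $\langle P\mid w\rangle$ is the coefficient of the word $w$ in $P$, extended to a bilinear pairing for which words are orthonormal. The $q$-stuffle product $\star$ is the bilinear product on $\mathbf{k}\langle Y\rangle$ with $u\star 1_{Y^*}=1_{Y^*}\star u=u$ and $y_su\star y_tv=y_s(u\star y_tv)+y_t(y_su\star v)+q\,y_{s+t}(u\star v)$; it is commutative, associative and unital. For $w\in Y^+$ set $$\pi_1(w)=w+\sum_{k\ge2}\frac{(-1)^{k-1}}{k}\sum_{u_1,\dots,u_k\in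 Y^+}\langle w\mid u_1\star\cdots\star u_k\rangle\,u_1\cdots u_k,$$ $$\check\pi_1(w)=w+\sum_{k\ge2}\frac{(-1)^{k-1}}{k}\sum_{u_1,\dots,u_k\in Y^+}\langle w\mid u_1\cdots u_k\rangle\,u_1\star\cdots\star u_k.$$ A Lyndon word is a nonempty word strictly smaller than each of its proper nonempty right factors; the standard factorization of a Lyndon word $l$ of length $\ge 2$ is $(s,r)$ with $l=sr$ and $r$ the longest proper right factor of $l$ that is Lyndon (then $s$ is Lyndon). Every word factors uniquely as $w=l_1^{i_1}\cdots l_k^{i_k}$ with $l_1>\cdots>l_k$ Lyndon. Define $\Pi_{y_k}=\pi_1(y_k)$; $\Pi_l=[\Pi_s,\Pi_r]=\Pi_s\Pi_r-\Pi_r\Pi_s$ for $l$ Lyndon of length $\ge2$ with standard factorization $(s,r)$; $\Pi_w=\Pi_{l_1}^{i_1}\cdots\Pi_{l_k}^{i_k}$ for $w=l_1^{i_1}\cdots l_k^{i_k}$ with $l_1>\cdots>l_k$ Lyndon words and $i_1,\dots,i_k\ge1$ ($\Pi_{1_{Y^*}}=1$). The family $\{\Pi_w\}$ is a basis of $\mathbf{k}\langle Y\rangle$, homogeneous for the weight (the weight of $y_{i_1}\cdots y_{i_r}$ is $i_1+\cdots+i_r$), and $\{\Sigma_w\}_{w\in Y^*}$ is the dual family in $\mathbf{k}\langle Y\rangle$, determined by $\langle\Sigma_v\mid\Pi_u\rangle=\delta_{u,v}$ for all $u,v\in Y^*$. *)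

theory Defs
  imports Complex_Main "HOL-Library.Poly_Mapping" "HOL-Library.List_Lexorder"
begin

text \<open>A commutative unital \<open>\<rat>\<close>-algebra: a commutative ring together with its (unique) unital ring
  homomorphism from \<open>\<rat>\<close>. As usual for \<^class>\<open>comm_ring_1\<close>, the zero ring is excluded.\<close>

class comm_rat_algebra_1 = comm_ring_1 +
  fixes of_Q :: "rat \<Rightarrow> 'a"
  assumes of_Q_1: "of_Q 1 = 1"
    and of_Q_add: "of_Q (a + b) = of_Q a + of_Q b"
    and of_Q_mult: "of_Q (a * b) = of_Q a * of_Q b"

instantiation rat :: comm_rat_algebra_1
begin
definition of_Q_rat :: "rat \<Rightarrow> rat" where "of_Q_rat r = r"
instance by standard (simp_all add: of_Q_rat_def)
end


typedef letter = "{s::nat. 1 \<le> s}" morphisms index y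
  by auto

text \<open>The order is reversed: \<open>y 1 > y 2 > \<dots>\<close>.\<close>

instantiation letter :: linorder
begin
definition less_eq_letter :: "letter \<Rightarrow> letter \<Rightarrow> bool" where "a \<le> b \<longleftrightarrow> index b \<le> index a"
definition less_letter :: "letter \<Rightarrow> letter \<Rightarrow> bool" where "a < b \<longleftrightarrow> index b < index a"
instance by standard (auto simp: less_eq_letter_def less_letter_def index_inject)
end

text \<open>Words are lists; \<^theory>\<open>HOL-Library.List_Lexorder\<close> orders them lexicographically, a proper
  prefix being smaller.\<close>

type_synonym word = "letter list"

definition weight :: "word \<Rightarrow> nat" where
  "weight w = (\<Sum>a\<leftarrow>w. index a)"

text \<open>Lists form the free monoid, written additively so that \<^theory>\<open>HOL-Library.Poly_Mapping\<close> makes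
  the finitely supported functions on words a ring whose product is concatenation.\<close>

instantiation list :: (type) monoid_add
begin
definition zero_list :: "'a list" where "zero_list = []"
definition plus_list :: "'a list \<Rightarrow> 'a list \<Rightarrow> 'a list" where "plus_list u v = u @ v"
instance by standard (simp_all add: zero_list_def plus_list_def)
end

type_synonym 'k ncpoly = "word \<Rightarrow>\<^sub>0 'k"

definition mon :: "word \<Rightarrow> 'k::comm_ring_1 ncpoly" where
  "mon w = Poly_Mapping.single w 1"

lemma mon_Nil: "mon [] = 1"
  by (simp add: mon_def flip: zero_list_def)

lemma mon_append: "mon (u @ v) = mon u * mon v"
  by (simp add: mon_def mult_single plus_list_def)

definition smult :: "'k::comm_ring_1 \<Rightarrow> 'k ncpoly \<Rightarrow> 'k ncpoly" where
  "smult c P = Poly_Mapping.map ((*) c) P"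

lemma lookup_smult: "Poly_Mapping.lookup (smult c P) w = c * Poly_Mapping.lookup P w"
  by (simp add: smult_def Poly_Mapping.map.rep_eq when_def)

definition pairing :: "'k::comm_ring_1 ncpoly \<Rightarrow> 'k ncpoly \<Rightarrow> 'k" where
  "pairing P R = (\<Sum>w\<in>Poly_Mapping.keys P. Poly_Mapping.lookup P w * Poly_Mapping.lookup R w)"

lemma pairing_mon: "pairing (mon w) P = Poly_Mapping.lookup P w"
  by (simp add: pairing_def mon_def)


fun stuffle_words :: "'k::comm_ring_1 \<Rightarrow> word \<Rightarrow> word \<Rightarrow> 'k ncpoly" where
  "stuffle_words q u [] = mon u"
| "stuffle_words q [] v = mon v"
| "stuffle_words q (a # u) (b # v) =
     mon [a] * stuffle_words q u (b # v)
     + mon [b] * stuffle_words q (a # u) v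
     + smult q (mon [y (index a + index b)] * stuffle_words q u v)"

definition stuffle :: "'k::comm_ring_1 \<Rightarrow> 'k ncpoly \<Rightarrow> 'k ncpoly \<Rightarrow> 'k ncpoly" where
  "stuffle q P R = (\<Sum>u\<in>Poly_Mapping.keys P. \<Sum>v\<in>Poly_Mapping.keys R.
     smult (Poly_Mapping.lookup P u * Poly_Mapping.lookup R v) (stuffle_words q u v))"

definition stuffle_list :: "'k::comm_ring_1 \<Rightarrow> 'k ncpoly list \<Rightarrow> 'k ncpoly" where
  "stuffle_list q Ps = foldr (stuffle q) Ps 1"

definition stuffle_pow :: "'k::comm_ring_1 \<Rightarrow> 'k ncpoly \<Rightarrow> nat \<Rightarrow> 'k ncpoly" where
  "stuffle_pow q P i = (stuffle q P ^^ i) 1"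


text \<open>\<open>tuples k\<close> is the set of all \<open>(u\<^sub>1, \<dots>, u\<^sub>k)\<close> with each \<open>u\<^sub>i\<close> a nonempty word. The sums below are
  over finitely supported families (proved as \<open>finite_support_\<dots>\<close>), so that \<^const>\<open>Sum_any\<close> is the
  intended sum.\<close>

definition tuples :: "nat \<Rightarrow> word list set" where
  "tuples k = {us. length us = k \<and> [] \<notin> set us}"

definition pi1_summand :: "'k::comm_ring_1 \<Rightarrow> word \<Rightarrow> nat \<Rightarrow> word list \<Rightarrow> 'k ncpoly" where
  "pi1_summand q w k us =
     (if us \<in> tuples k
      then smult (pairing (mon w) (stuffle_list q (map mon us))) (prod_list (map mon us)) else 0)"

definition pi1 :: "'k::comm_rat_algebra_1 \<Rightarrow> word \<Rightarrow> 'k ncpoly" where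
  "pi1 q w = mon w +
     Sum_any (\<lambda>k. if 2 \<le> k
       then smult (of_Q ((-1) ^ (k - 1) / of_nat k)) (Sum_any (pi1_summand q w k)) else 0)"

definition check_pi1_summand :: "'k::comm_ring_1 \<Rightarrow> word \<Rightarrow> nat \<Rightarrow> word list \<Rightarrow> 'k ncpoly" where
  "check_pi1_summand q w k us =
     (if us \<in> tuples k
      then smult (pairing (mon w) (prod_list (map mon us))) (stuffle_list q (map mon us)) else 0)"

definition check_pi1 :: "'k::comm_rat_algebra_1 \<Rightarrow> word \<Rightarrow> 'k ncpoly" where
  "check_pi1 q w = mon w +
     Sum_any (\<lambda>k. if 2 \<le> k
       then smult (of_Q ((-1) ^ (k - 1) / of_nat k)) (Sum_any (check_pi1_summand q w k)) else 0)"

lemma smult_0: "smult 0 P = 0"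
  by (rule poly_mapping_eqI) (simp add: lookup_smult)

lemma keys_smult: "Poly_Mapping.keys (smult c P) \<subseteq> Poly_Mapping.keys P"
  by (auto simp: in_keys_iff lookup_smult)

lemma keys_mon: "Poly_Mapping.keys (mon w :: 'k::comm_ring_1 ncpoly) = {w}"
  by (simp add: mon_def)

lemma keys_mult_weight:
  assumes "Poly_Mapping.keys P \<subseteq> {w. weight w = m}" "Poly_Mapping.keys R \<subseteq> {w. weight w = n}"
  shows "Poly_Mapping.keys (P * R) \<subseteq> {w. weight w = m + n}"
  using keys_mult[of P R] assms by (fastforce simp: plus_list_def weight_def)

lemma index_y_add [simp]: "index (y (index a + index b)) = index a + index b"
  using index[of a] by (subst y_inverse) auto

lemma keys_stuffle_words:
  "Poly_Mapping.keys (stuffle_words q u v) \<subseteq> {w. weight w = weight u + weight v}"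
proof (induction q u v rule: stuffle_words.induct)
  case (3 q a u b v)
  have m: "Poly_Mapping.keys (mon [c] :: 'a ncpoly) \<subseteq> {w. weight w = index c}" for c
    by (simp add: keys_mon weight_def)
  let ?W = "{w. weight w = weight (a # u) + weight (b # v)}"
  have 1: "Poly_Mapping.keys (mon [a] * stuffle_words q u (b # v)) \<subseteq> ?W"
    using keys_mult_weight[OF m[of a] "3.IH"(1)] by (simp add: weight_def add_ac)
  have 2: "Poly_Mapping.keys (mon [b] * stuffle_words q (a # u) v) \<subseteq> ?W"
    using keys_mult_weight[OF m[of b] "3.IH"(2)] by (simp add: weight_def add_ac)
  have "Poly_Mapping.keys (mon [y (index a + index b)] * stuffle_words q u v) \<subseteq> ?W"
    using keys_mult_weight[OF m[of "y (index a + index b)"] "3.IH"(3)]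
    by (simp add: weight_def add_ac)
  then have 3: "Poly_Mapping.keys (smult q (mon [y (index a + index b)] * stuffle_words q u v)) \<subseteq> ?W"
    by (rule subset_trans[OF keys_smult])
  show ?case
    unfolding stuffle_words.simps
    by (intro subset_trans[OF keys_add] Un_least 1 2 3)
qed (simp_all add: keys_mon weight_def)

lemma keys_stuffle_weight:
  assumes "Poly_Mapping.keys P \<subseteq> {w. weight w = m}" "Poly_Mapping.keys R \<subseteq> {w. weight w = n}"
  shows "Poly_Mapping.keys (stuffle q P R) \<subseteq> {w. weight w = m + n}"
proof
  fix w assume "w \<in> Poly_Mapping.keys (stuffle q P R)"
  then obtain u v where u: "u \<in> Poly_Mapping.keys P" and v: "v \<in> Poly_Mapping.keys R"
    and "w \<in> Poly_Mapping.keys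
      (smult (Poly_Mapping.lookup P u * Poly_Mapping.lookup R v) (stuffle_words q u v))"
    unfolding stuffle_def by (blast dest!: subsetD[OF keys_sum])
  then have "w \<in> {w. weight w = weight u + weight v}"
    by (blast dest: subsetD[OF keys_smult] subsetD[OF keys_stuffle_words])
  with u v show "w \<in> {w. weight w = m + n}" using assms by auto
qed

lemma keys_stuffle_list_mon:
  "Poly_Mapping.keys (stuffle_list q (map mon us)) \<subseteq> {w. weight w = weight (concat us)}"
proof (induction us)
  case Nil
  show ?case by (simp add: stuffle_list_def keys_mon flip: mon_Nil)
next
  case (Cons u us)
  have "Poly_Mapping.keys (mon u :: 'a ncpoly) \<subseteq> {w. weight w = weight u}"
    by (simp add: keys_mon)
  from keys_stuffle_weight[OF this Cons.IH, of q] show ?case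
    by (simp add: stuffle_list_def weight_def)
qed

lemma prod_list_mon: "prod_list (map mon us) = mon (concat us)"
  by (induction us) (simp_all add: mon_Nil mon_append)

lemma length_le_weight: "length w \<le> weight w"
proof (induction w)
  case (Cons a w)
  then show ?case using index[of a] by (simp add: weight_def)
qed (simp add: weight_def)

lemma length_le_concat: "[] \<notin> set us \<Longrightarrow> length us \<le> length (concat us)"
proof (induction us)
  case (Cons u us)
  then show ?case by (cases u) auto
qed simp

lemma index_le_weight: "a \<in> set w \<Longrightarrow> index a \<le> weight w"
  by (induction w) (auto simp: weight_def)

lemma finite_letters: "finite {a. index a \<le> n}"
proof (rule finite_subset)
  show "{a. index a \<le> n} \<subseteq> y ` {..n}"
    using index_inverse by (auto intro: image_eqI sym)
qed simp

lemma finite_words: "finite {w. weight w \<le> n}"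
proof (rule finite_subset)
  show "{w. weight w \<le> n} \<subseteq> {w. set w \<subseteq> {a. index a \<le> n} \<and> length w \<le> n}"
    by (auto intro: order_trans[OF length_le_weight] order_trans[OF index_le_weight])
  show "finite {w. set w \<subseteq> {a. index a \<le> n} \<and> length w \<le> n}"
    by (rule finite_lists_length_le) (rule finite_letters)
qed

lemma finite_tuples: "finite {us. [] \<notin> set us \<and> weight (concat us) = n}"
proof (rule finite_subset)
  have "weight u \<le> weight (concat us)" if "u \<in> set us" for u us
    using that by (induction us) (auto simp: weight_def)
  moreover have "length us \<le> weight (concat us)" if "[] \<notin> set us" for us
    using length_le_concat[OF that] length_le_weight by (rule order_trans)
  ultimately show "{us. [] \<notin> set us \<and> weight (concat us) = n}
      \<subseteq> {us. set us \<subseteq> {w. weight w \<le> n} \<and> length us \<le> n}"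
    by blast
  show "finite {us. set us \<subseteq> {w. weight w \<le> n} \<and> length us \<le> n}"
    by (rule finite_lists_length_le) (rule finite_words)
qed

lemma pi1_summand_nonzero:
  assumes "pi1_summand q w k us \<noteq> 0"
  shows "us \<in> tuples k" "weight (concat us) = weight w"
proof -
  show "us \<in> tuples k" using assms by (auto simp: pi1_summand_def split: if_splits)
  have "w \<in> Poly_Mapping.keys (stuffle_list q (map mon us))"
    using assms
    by (auto simp: pi1_summand_def pairing_mon in_keys_iff smult_0 split: if_splits)
  then show "weight (concat us) = weight w" using keys_stuffle_list_mon by fastforce
qed

lemma check_pi1_summand_nonzero:
  assumes "check_pi1_summand q w k us \<noteq> 0"
  shows "us \<in> tuples k" "concat us = w"
proof -
  show "us \<in> tuples k" using assms by (auto simp: check_pi1_summand_def split: if_splits)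
  have "w \<in> Poly_Mapping.keys (prod_list (map mon us) :: 'a ncpoly)"
    using assms
    by (auto simp: check_pi1_summand_def pairing_mon in_keys_iff smult_0 split: if_splits)
  then show "concat us = w" by (simp add: prod_list_mon keys_mon)
qed

lemma finite_support_pi1_summand: "finite {us. pi1_summand q w k us \<noteq> 0}"
  by (rule finite_subset[OF _ finite_tuples[of "weight w"]])
     (auto dest: pi1_summand_nonzero simp: tuples_def)

lemma finite_support_check_pi1_summand: "finite {us. check_pi1_summand q w k us \<noteq> 0}"
  by (rule finite_subset[OF _ finite_tuples[of "weight w"]])
     (auto dest: check_pi1_summand_nonzero simp: tuples_def)

lemma finite_support_pi1: "finite {k. Sum_any (pi1_summand q w k) \<noteq> 0}"
proof (rule finite_subset)
  show "{k. Sum_any (pi1_summand q w k) \<noteq> 0} \<subseteq> {..weight w}"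
  proof
    fix k assume "k \<in> {k. Sum_any (pi1_summand q w k) \<noteq> 0}"
    then obtain us where "pi1_summand q w k us \<noteq> 0"
      using Sum_any.not_neutral_obtains_not_neutral by blast
    note us = pi1_summand_nonzero[OF this]
    have "length us \<le> length (concat us)"
      using us(1) by (intro length_le_concat) (simp add: tuples_def)
    also have "\<dots> \<le> weight (concat us)" by (rule length_le_weight)
    finally show "k \<in> {..weight w}" using us by (simp add: tuples_def)
  qed
qed simp

lemma finite_support_check_pi1: "finite {k. Sum_any (check_pi1_summand q w k) \<noteq> 0}"
proof (rule finite_subset)
  show "{k. Sum_any (check_pi1_summand q w k) \<noteq> 0} \<subseteq> {..length w}"
  proof
    fix k assume "k \<in> {k. Sum_any (check_pi1_summand q w k) \<noteq> 0}"
    then obtain us where "check_pi1_summand q w k us \<noteq> 0"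
      using Sum_any.not_neutral_obtains_not_neutral by blast
    note us = check_pi1_summand_nonzero[OF this]
    have "length us \<le> length (concat us)"
      using us(1) by (intro length_le_concat) (simp add: tuples_def)
    then show "k \<in> {..length w}" using us by (simp add: tuples_def)
  qed
qed simp


definition lyndon :: "word \<Rightarrow> bool" where
  "lyndon l \<longleftrightarrow> l \<noteq> [] \<and> (\<forall>u v. l = u @ v \<and> u \<noteq> [] \<and> v \<noteq> [] \<longrightarrow> l < v)"

text \<open>\<open>r\<close> is the longest Lyndon proper right factor of \<open>l = s @ r\<close>.\<close>

definition is_standard_factorization :: "word \<Rightarrow> word \<times> word \<Rightarrow> bool" where
  "is_standard_factorization l = (\<lambda>(s, r). l = s @ r \<and> s \<noteq> [] \<and> lyndon r \<and>
     (\<forall>s' r'. l = s' @ r' \<and> s' \<noteq> [] \<and> lyndon r' \<longrightarrow> length r' \<le> length r))"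

definition standard_factorization :: "word \<Rightarrow> word \<times> word" where
  "standard_factorization l = (THE p. is_standard_factorization l p)"

lemma lyndon_letter: "lyndon [a]"
  by (auto simp: lyndon_def Cons_eq_append_conv)

lemma is_standard_factorization:
  assumes "2 \<le> length l"
  shows "is_standard_factorization l (standard_factorization l)"
proof -
  define R where "R = {r. \<exists>s. l = s @ r \<and> s \<noteq> [] \<and> lyndon r}"
  have fin: "finite (length ` R)"
    by (rule finite_subset[of _ "{..length l}"]) (auto simp: R_def)
  have "l = butlast l @ [last l]" "butlast l \<noteq> []"
    using assms by (cases l rule: rev_cases; auto)+
  then have "[last l] \<in> R" using lyndon_letter unfolding R_def by blast
  then have "Max (length ` R) \<in> length ` R" using fin by (intro Max_in) auto
  then obtain r where r: "r \<in> R" "length r = Max (length ` R)" by auto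
  then obtain s where s: "l = s @ r" "s \<noteq> []" "lyndon r" by (auto simp: R_def)
  have max: "length r' \<le> length r" if "r' \<in> R" for r' using fin r(2) that by simp
  have "is_standard_factorization l (s, r)"
    using s max by (auto simp: is_standard_factorization_def R_def)
  moreover have "p = (s, r)" if "is_standard_factorization l p" for p
  proof -
    obtain s' r' where p: "p = (s', r')" by force
    have "l = s' @ r'" "s' \<noteq> []" "lyndon r'" "length r \<le> length r'"
      using that s unfolding p is_standard_factorization_def by auto
    moreover from this have "length r' \<le> length r" by (intro max) (auto simp: R_def)
    ultimately show ?thesis using s(1) p by (metis append_eq_append_conv le_antisym)
  qed
  ultimately show ?thesis unfolding standard_factorization_def by (rule theI)
qed

lemma length_standard_factorization:
  assumes "2 \<le> length l"
  shows "length (fst (standard_factorization l)) < length l"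
    "length (snd (standard_factorization l)) < length l"
  using is_standard_factorization[OF assms]
  by (auto simp: is_standard_factorization_def lyndon_def split: prod.splits)

text \<open>Only the values at Lyndon words are meaningful.\<close>

function Pi_lyndon :: "'k::comm_rat_algebra_1 \<Rightarrow> word \<Rightarrow> 'k ncpoly" where
  "Pi_lyndon q l =
     (if length l < 2 then pi1 q l
      else let s = fst (standard_factorization l); r = snd (standard_factorization l)
           in Pi_lyndon q s * Pi_lyndon q r - Pi_lyndon q r * Pi_lyndon q s)"
  by auto
termination
  by (relation "measure (\<lambda>(q, l). length l)") (simp_all add: length_standard_factorization)

declare Pi_lyndon.simps [simp del]

text \<open>The list \<open>[(l\<^sub>1, i\<^sub>1), \<dots>, (l\<^sub>k, i\<^sub>k)]\<close> represents \<open>l\<^sub>1\<^bsup>i\<^sub>1\<^esup> \<dots> l\<^sub>k\<^bsup>i\<^sub>k\<^esup>\<close>; the empty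
  word has the empty factorization.\<close>

definition is_lyndon_factorization :: "word \<Rightarrow> (word \<times> nat) list \<Rightarrow> bool" where
  "is_lyndon_factorization w fs \<longleftrightarrow>
     w = concat (map (\<lambda>(l, i). concat (replicate i l)) fs) \<and>
     (\<forall>(l, i) \<in> set fs. lyndon l \<and> 1 \<le> i) \<and>
     sorted_wrt (>) (map fst fs)"

definition lyndon_factorization :: "word \<Rightarrow> (word \<times> nat) list" where
  "lyndon_factorization w = (THE fs. is_lyndon_factorization w fs)"

definition Pi_word :: "'k::comm_rat_algebra_1 \<Rightarrow> word \<Rightarrow> 'k ncpoly" where
  "Pi_word q w = prod_list (map (\<lambda>(l, i). Pi_lyndon q l ^ i) (lyndon_factorization w))"

definition Sigma_word :: "'k::comm_rat_algebra_1 \<Rightarrow> word \<Rightarrow> 'k ncpoly" where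
  "Sigma_word q v = (THE S. \<forall>u. pairing S (Pi_word q u) = (if u = v then 1 else 0))"

end

theory Submission
  imports Defs "HOL-Library.Product_Plus"
begin

text \<open>The stuffle product is dual to a coproduct \<open>\<Delta>\<close> that is an algebra morphism for
  concatenation, and \<open>\<Pi>\<^sub>l\<close> is primitive for every Lyndon word \<open>l\<close>: the generating series of the
  \<open>\<pi>\<^sub>1(y\<^sub>s)\<close> is the logarithm of a group-like series, and commutators of primitive elements are
  primitive. Hence \<open>\<Delta>\<close> of a nonincreasing product of elements \<open>\<Pi>\<^sub>l\<close> is the sum over all ways
  to distribute its factors, in order, over the two tensor positions, where they again form
  nonincreasing products. Pairing with \<open>\<Sigma>\<^sub>u \<otimes> \<Sigma>\<^sub>v\<close> therefore counts such distributions, which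
  gives binomial coefficients and so the factorials. The dual family exists and is unique because
  \<open>\<Pi>\<^sub>w\<close> is \<open>w\<close> plus words of the same weight that are longer, or equally long and
  lexicographically larger.\<close>

section \<open>Lyndon words\<close>

text \<open>The generating series of the primitive elements is
  \<open>(1/q) log (1 + q (y 1 + y 2 + ...))\<close>, but \<open>q\<close> may be zero or a zero
  divisor, so the series is never formed. Primitivity is checked on each pair of nonempty words
  instead. There the powers of \<open>q\<close> come out as a common factor, and what remains
  concerns rationals only: the coefficients \<open>(-1) ^ (n - 1) / n\<close>, summed over the
  lengths \<open>n\<close> of all quasi-shuffles of two nonempty words, cancel. The reason is that
  they are the derivatives at \<open>z = 0\<close> of \<open>z choose n\<close>, and that summing
  \<open>z choose n\<close> over the quasi-shuffles of words of lengths \<open>a\<close> and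
  \<open>b\<close> gives \<open>(z choose a) (z choose b)\<close>, which has a double zero at 0 when
  \<open>a\<close> and \<open>b\<close> are positive. The other obstacle is repetition of Lyndon
  factors. Factorizations are handled as plain nonincreasing lists, whose entries can be distributed
  one by one; exponents are read off as multiplicities. Since the largest factor is always the one
  multiplied on, every intermediate product is a multiple of a single dual element.\<close>

lemma append_less_append_iff [simp]: "w @ u < w @ v \<longleftrightarrow> u < (v :: 'a::linorder list)"
  by (induction w) auto

lemma append_le_append_iff [simp]: "w @ u \<le> w @ v \<longleftrightarrow> u \<le> (v :: 'a::linorder list)"
  by (induction w) auto

lemma le_append: "u \<le> u @ (v :: 'a::linorder list)"
  using append_le_append_iff[of u "[]" v] by simp

text \<open>The second case survives arbitrary continuations of both words. The first does not, and
  is where the Lyndon property has to intervene.\<close>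

lemma less_list_cases:
  fixes u v :: "'a::linorder list"
  assumes "u < v"
  obtains (prefix) t where "t \<noteq> []" "v = u @ t" | (differ) "\<And>x z. u @ x < v @ z"
proof -
  have "(\<exists>t. t \<noteq> [] \<and> v = u @ t) \<or> (\<forall>x z. u @ x < v @ z)"
    using assms
  proof (induction u arbitrary: v)
    case Nil
    then show ?case by auto
  next
    case (Cons a u)
    then obtain b v' where v: "v = b # v'" by (cases v) auto
    show ?case
    proof (cases "a < b")
      case True
      then show ?thesis by (simp add: v)
    next
      case False
      then have "a = b" "u < v'" using Cons.prems by (auto simp: v)
      then show ?thesis using Cons.IH[of v'] by (simp add: v)
    qed
  qed
  then show thesis using that by blast
qed

lemma less_append_same_length:
  fixes u v :: "'a::linorder list"
  assumes "length u = length v" "u < v"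
  shows "u @ x < v @ z"
  using assms(2) by (cases rule: less_list_cases) (use assms(1) in auto)

lemma append_le_append:
  fixes u v :: "'a::linorder list"
  assumes "length u = length u'" "u \<le> u'" "v \<le> v'"
  shows "u @ v \<le> u' @ v'"
  using assms less_append_same_length[of u u' v v'] by (cases "u = u'") (auto simp: order_less_imp_le)

lemma lyndonD: "lyndon l \<Longrightarrow> l = u @ v \<Longrightarrow> u \<noteq> [] \<Longrightarrow> v \<noteq> [] \<Longrightarrow> l < v"
  by (auto simp: lyndon_def)

lemma lyndon_le_suffix: "lyndon l \<Longrightarrow> l = u @ v \<Longrightarrow> v \<noteq> [] \<Longrightarrow> l \<le> v"
  using lyndonD[of l u v] by (cases "u = []") (auto intro: order_less_imp_le)

text \<open>If \<open>v = u @ t\<close>, then \<open>v < t\<close>, and prefixing \<open>u\<close>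
  gives \<open>u @ v < v\<close>; this settles all suffixes of \<open>v\<close>. Any other proper
  suffix is \<open>t @ v\<close> with \<open>u < t\<close>, where \<open>t\<close> is shorter than
  \<open>u\<close>, so that \<open>u\<close> is no prefix of \<open>t\<close> and the two differ at
  a letter.\<close>

lemma lyndon_append:
  assumes "lyndon u" "lyndon v" "u < v"
  shows "lyndon (u @ v)"
proof -
  have ne: "u \<noteq> []" "v \<noteq> []" using assms by (auto simp: lyndon_def)
  have uv: "u @ v < v"
    using \<open>u < v\<close>
  proof (cases rule: less_list_cases)
    case (prefix t)
    then have "v < t" using lyndonD[OF \<open>lyndon v\<close>, of u t] ne by simp
    then show ?thesis using prefix by simp
  next
    case differ
    from differ[of v "[]"] show ?thesis by simp
  qed
  show ?thesis unfolding lyndon_def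
  proof (intro conjI allI impI)
    fix p x assume *: "u @ v = p @ x \<and> p \<noteq> [] \<and> x \<noteq> []"
    have "(\<exists>t. v = t @ x) \<or> (\<exists>t. t \<noteq> [] \<and> u = p @ t \<and> x = t @ v)"
      using * unfolding append_eq_append_conv2 by (metis append_Nil)
    then consider t where "v = t @ x" | t where "t \<noteq> []" "u = p @ t" "x = t @ v"
      by blast
    then show "u @ v < x"
    proof cases
      case 1
      then have "v \<le> x" using lyndon_le_suffix[OF \<open>lyndon v\<close>] * by blast
      with uv show ?thesis by (rule order_less_le_trans)
    next
      case 2
      then have "u < t" using lyndonD[OF \<open>lyndon u\<close>] * by blast
      then show ?thesis
      proof (cases rule: less_list_cases)
        case (prefix t')
        then have "length t = length u + length t'" by simp
        then show ?thesis using 2 * by simp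
      qed (use 2 in simp)
    qed
  qed (use ne in simp)
qed

text \<open>The smallest proper suffix \<open>m\<close> is Lyndon, since its own suffixes compete
  for the minimum. Hence \<open>m\<close> is no longer than \<open>r\<close> and is a suffix of it;
  were it a proper one, \<open>r\<close> being Lyndon would give \<open>r < m\<close>.\<close>

lemma standard_factorization_minimal:
  assumes "2 \<le> length l" "standard_factorization l = (s, r)" "l = p @ x" "p \<noteq> []" "x \<noteq> []"
  shows "r \<le> x"
proof -
  have sf: "l = s @ r" "s \<noteq> []" "lyndon r"
    and longest: "\<And>s' r'. l = s' @ r' \<Longrightarrow> s' \<noteq> [] \<Longrightarrow> lyndon r' \<Longrightarrow> length r' \<le> length r"
    using is_standard_factorization[OF assms(1)] assms(2)
    by (auto simp: is_standard_factorization_def)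
  define R where "R = {x. x \<noteq> [] \<and> (\<exists>p. p \<noteq> [] \<and> l = p @ x)}"
  have fin: "finite R"
    by (rule finite_subset[of _ "{x. set x \<subseteq> set l \<and> length x \<le> length l}"])
      (auto simp: R_def intro!: finite_lists_length_le)
  have x: "x \<in> R" using assms by (auto simp: R_def)
  define m where "m = Min R"
  have m: "m \<in> R" using Min_in[OF fin] x by (auto simp: m_def)
  have min: "m \<le> z" if "z \<in> R" for z using fin that by (simp add: m_def)
  obtain p' where p': "p' \<noteq> []" "l = p' @ m" "m \<noteq> []" using m by (auto simp: R_def)
  have "lyndon m" unfolding lyndon_def
  proof (intro conjI allI impI)
    fix a b assume ab: "m = a @ b \<and> a \<noteq> [] \<and> b \<noteq> []"
    then have "l = (p' @ a) @ b \<and> p' @ a \<noteq> []" using p' by simp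
    then have "b \<in> R" using ab unfolding R_def by blast
    then have "m \<le> b" by (rule min)
    moreover have "m \<noteq> b" using ab by auto
    ultimately show "m < b" by simp
  qed (use p' in simp)
  then have len: "length m \<le> length r" using longest p' by blast
  have "m = r"
  proof (rule ccontr)
    assume "m \<noteq> r"
    obtain t where t: "r = t @ m"
      using p' sf(1) len by (auto simp: append_eq_append_conv2)
    with \<open>m \<noteq> r\<close> have "r < m" using lyndonD[OF sf(3) t] p' by auto
    moreover have "r \<in> R" using sf by (auto simp: R_def lyndon_def)
    ultimately show False using min[of r] by auto
  qed
  then show ?thesis using min[OF x] by simp
qed

text \<open>The right factor is the smallest proper suffix of \<open>l\<close>, not merely its longest Lyndon one;
  this rules out a proper suffix of \<open>s\<close> that is also a prefix of \<open>s\<close>.\<close>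

lemma standard_factorization_lyndon:
  assumes "2 \<le> length l" "lyndon l" "standard_factorization l = (s, r)"
  shows "l = s @ r" "lyndon s" "lyndon r"
proof -
  have sf: "l = s @ r" "s \<noteq> []" "lyndon r"
    using is_standard_factorization[OF assms(1)] assms(3)
    by (auto simp: is_standard_factorization_def)
  show "l = s @ r" "lyndon r" by fact+
  show "lyndon s" unfolding lyndon_def
  proof (intro conjI allI impI)
    fix u v assume uv: "s = u @ v \<and> u \<noteq> [] \<and> v \<noteq> []"
    have l: "l < v @ r" using lyndonD[OF assms(2), of u "v @ r"] uv sf by simp
    show "s < v"
    proof (rule ccontr)
      assume "\<not> s < v"
      moreover have "v \<noteq> s" using uv by auto
      ultimately have "v < s" by auto
      then show False
      proof (cases rule: less_list_cases)
        \<comment> \<open>Here \<open>s = v @ t\<close>. Cancelling \<open>v\<close> in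
          \<open>l < v @ r\<close> puts the proper suffix \<open>t @ r\<close> of \<open>l\<close>
          below \<open>r\<close>.\<close>
        case (prefix t)
        then have "t @ r < r" using l sf by simp
        moreover have "r \<le> t @ r"
          using standard_factorization_minimal[OF assms(1,3), of v "t @ r"] prefix sf uv by auto
        ultimately show False by auto
      next
        case differ
        from differ[of r r] show False using l sf by auto
      qed
    qed
  qed (use sf in simp)
qed

section \<open>Nonincreasing factorization into Lyndon words\<close>

definition lyndon_list :: "word list \<Rightarrow> bool" where
  "lyndon_list ms \<longleftrightarrow> (\<forall>m\<in>set ms. lyndon m) \<and> sorted_wrt (\<ge>) ms"

lemma lyndon_list_Cons:
  "lyndon_list (m # ms) \<longleftrightarrow> lyndon m \<and> (\<forall>x\<in>set ms. x \<le> m) \<and> lyndon_list ms"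
  by (auto simp: lyndon_list_def)

text \<open>A suffix \<open>x\<close> that starts inside a factor \<open>a\<close> begins with a
  suffix \<open>t\<close> of \<open>a\<close>, and \<open>m \<le> a \<le> t \<le> x\<close>.\<close>

lemma lyndon_list_snoc_le_suffix:
  assumes "lyndon_list (ms @ [m])" "concat (ms @ [m]) = p @ x" "x \<noteq> []"
  shows "m \<le> x"
  using assms
proof (induction ms arbitrary: p)
  case Nil
  then show ?case by (auto simp: lyndon_list_def dest: lyndon_le_suffix)
next
  case (Cons a ms)
  then have a: "lyndon a" "m \<le> a" by (auto simp: lyndon_list_def)
  have "(\<exists>t. concat (ms @ [m]) = t @ x) \<or> (\<exists>t. t \<noteq> [] \<and> a = p @ t \<and> x = t @ concat (ms @ [m]))"
    using Cons.prems(2) by (simp add: append_eq_append_conv2) (metis append_Nil)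
  then consider t where "concat (ms @ [m]) = t @ x"
    | t where "t \<noteq> []" "a = p @ t" "x = t @ concat (ms @ [m])"
    by blast
  then show ?case
  proof cases
    case 1
    then show ?thesis using Cons by (auto simp: lyndon_list_Cons)
  next
    case 2
    then have "a \<le> t" using a lyndon_le_suffix by blast
    also have "t \<le> x" using 2 by (simp add: le_append)
    finally show ?thesis using a by simp
  qed
qed

text \<open>The last factor is the smallest nonempty suffix of the word.\<close>

lemma lyndon_list_unique:
  assumes "lyndon_list ms" "lyndon_list ns" "concat ms = concat ns"
  shows "ms = ns"
  using assms
proof (induction ms arbitrary: ns rule: rev_induct)
  case Nil
  then show ?case by (cases ns) (auto simp: lyndon_list_def lyndon_def)
next
  case (snoc m ms)
  have m: "m \<noteq> []" using snoc.prems by (auto simp: lyndon_list_def lyndon_def)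
  then obtain ns' n where ns: "ns = ns' @ [n]" using snoc.prems by (cases ns rule: rev_cases) auto
  then have n: "n \<noteq> []" using snoc.prems by (auto simp: lyndon_list_def lyndon_def)
  have eq: "concat ms @ m = concat ns' @ n" using snoc.prems ns by simp
  have "m \<le> n"
    by (rule lyndon_list_snoc_le_suffix[OF snoc.prems(1) _ n, of "concat ns'"]) (use eq in simp)
  moreover have "n \<le> m"
    by (rule lyndon_list_snoc_le_suffix[OF snoc.prems(2)[unfolded ns] _ m, of "concat ms"]) (use eq in simp)
  ultimately have "m = n" by simp
  moreover have "ms = ns'"
  proof (rule snoc.IH)
    show "lyndon_list ms" "lyndon_list ns'"
      using snoc.prems by (auto simp: ns lyndon_list_def sorted_wrt_append)
    show "concat ms = concat ns'" using eq \<open>m = n\<close> by simp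
  qed
  ultimately show ?case using ns by simp
qed

text \<open>A word too small to stand before the head is fused with it into one Lyndon word, which
  is then inserted into the shorter tail.\<close>

lemma lyndon_list_insert:
  assumes "lyndon u" "lyndon_list ms"
  shows "\<exists>ns. lyndon_list ns \<and> concat ns = u @ concat ms"
  using assms
proof (induction ms arbitrary: u)
  case Nil
  then have "lyndon_list [u]" by (simp add: lyndon_list_def)
  then show ?case by force
next
  case (Cons m ms)
  show ?case
  proof (cases "u < m")
    case True
    then show ?thesis
      using Cons.IH[of "u @ m"] Cons.prems lyndon_append by (auto simp: lyndon_list_Cons)
  next
    case False
    then have "lyndon_list (u # m # ms)"
      using Cons.prems by (fastforce simp: lyndon_list_Cons)
    then show ?thesis by force
  qed
qed

lemma lyndon_list_exists: "\<exists>ms. lyndon_list ms \<and> concat ms = w"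
proof (induction w)
  case Nil
  have "lyndon_list []" by (simp add: lyndon_list_def)
  then show ?case by force
next
  case (Cons a w)
  then obtain ms where "lyndon_list ms" "concat ms = w" by blast
  then show ?case using lyndon_list_insert[OF lyndon_letter, of ms a] by simp
qed

section \<open>Factorizations with exponents as run-length encodings\<close>

definition expand :: "('a \<times> nat) list \<Rightarrow> 'a list" where
  "expand fs = concat (map (\<lambda>(l, i). replicate i l) fs)"

lemma expand_simps [simp]: "expand [] = []" "expand ((l, i) # fs) = replicate i l @ expand fs"
  by (simp_all add: expand_def)

lemma set_expand: "\<forall>(l, i) \<in> set fs. 1 \<le> i \<Longrightarrow> set (expand fs) = fst ` set fs"
proof (induction fs)
  case (Cons f fs)
  then show ?case by (cases f) (simp add: set_replicate_conv_if)
qed simp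

lemma concat_expand: "concat (expand fs) = concat (map (\<lambda>(l, i). concat (replicate i l)) fs)"
  by (induction fs) auto

lemma is_lyndon_factorization_Nil [simp]: "is_lyndon_factorization w [] \<longleftrightarrow> w = []"
  by (simp add: is_lyndon_factorization_def)

lemma is_lyndon_factorization_Cons:
  "is_lyndon_factorization w ((l, i) # fs) \<longleftrightarrow>
     (\<exists>v. w = concat (replicate i l) @ v \<and> is_lyndon_factorization v fs) \<and>
     lyndon l \<and> 1 \<le> i \<and> (\<forall>x \<in> fst ` set fs. x < l)"
  by (auto simp: is_lyndon_factorization_def)

lemma lyndon_list_expand:
  assumes "is_lyndon_factorization w fs"
  shows "lyndon_list (expand fs)" "concat (expand fs) = w"
proof -
  show "concat (expand fs) = w" using assms by (simp add: concat_expand is_lyndon_factorization_def)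
  show "lyndon_list (expand fs)" using assms
  proof (induction fs arbitrary: w)
    case Nil
    then show ?case by (simp add: lyndon_list_def)
  next
    case (Cons f fs)
    obtain l i where f: "f = (l, i)" by force
    obtain v where v: "is_lyndon_factorization v fs" and *: "lyndon l" "\<forall>x \<in> fst ` set fs. x < l"
      using Cons.prems by (auto simp: f is_lyndon_factorization_Cons)
    have "set (expand fs) = fst ` set fs"
      using v by (intro set_expand) (auto simp: is_lyndon_factorization_def)
    with * have "\<forall>x \<in> set (expand fs). x \<le> l" by auto
    then show ?case using * Cons.IH[OF v]
      by (auto simp: f lyndon_list_def sorted_wrt_append sorted_wrt_iff_nth_less[of _ "replicate i l"])
  qed
qed

lemma factorization_of_lyndon_list:
  assumes "lyndon_list ms"
  shows "\<exists>fs. is_lyndon_factorization (concat ms) fs \<and> expand fs = ms"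
  using assms
proof (induction ms)
  case Nil
  show ?case by (rule exI[of _ "[]"]) simp
next
  case (Cons m ms)
  then obtain fs where fs: "is_lyndon_factorization (concat ms) fs" "expand fs = ms"
    by (auto simp: lyndon_list_Cons)
  have m: "lyndon m" "\<forall>x\<in>set ms. x \<le> m" using Cons.prems by (auto simp: lyndon_list_Cons)
  have set: "set ms = fst ` set fs"
    using set_expand[of fs] fs by (force simp: is_lyndon_factorization_def)
  show ?case
  proof (cases "m \<in> set ms")
    case True
    \<comment> \<open>Since \<open>m\<close> bounds all entries and occurs among them, it is the
      base of the first pair, and only that exponent grows.\<close>
    then obtain i gs where gs: "fs = (m, i) # gs"
    proof (cases fs)
      case (Cons f gs)
      obtain l i where f: "f = (l, i)" by force
      have "l \<le> m" using m(2) by (simp add: set Cons f)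
      moreover have "\<forall>x \<in> fst ` set gs. x < l"
        using fs(1) by (simp add: Cons f is_lyndon_factorization_Cons)
      ultimately have "l = m" using True by (fastforce simp: set Cons f)
      then show ?thesis using that Cons f by simp
    qed (use set in simp)
    have "is_lyndon_factorization (concat (m # ms)) ((m, Suc i) # gs)"
      using fs(1) by (auto simp: gs is_lyndon_factorization_Cons)
    moreover have "expand ((m, Suc i) # gs) = m # ms" using fs(2) by (simp add: gs)
    ultimately show ?thesis by blast
  next
    case False
    then have "\<forall>x \<in> fst ` set fs. x < m" using m(2) unfolding set[symmetric] by (metis order_le_less)
    then have "is_lyndon_factorization (concat (m # ms)) ((m, 1) # fs)"
      using fs(1) m by (simp add: is_lyndon_factorization_Cons)
    moreover have "expand ((m, 1) # fs) = m # ms" using fs(2) by simp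
    ultimately show ?thesis by blast
  qed
qed

lemma count_expand:
  assumes "sorted_wrt (>) (map fst fs)" "(l, i) \<in> set fs"
  shows "count_list (expand fs) (l :: 'a::linorder) = i"
proof -
  have *: "count_list (expand gs) x = 0" if "x \<notin> fst ` set gs" for x :: 'a and gs
    using that by (induction gs) (auto simp: count_list_0_iff)
  have r: "count_list (replicate n x) y = (if x = y then n else 0)" for n and x y :: 'a
    by (induction n) auto
  show ?thesis using assms
  proof (induction fs)
    case (Cons f fs)
    show ?case
    proof (cases "f = (l, i)")
      case True
      then have "l \<notin> fst ` set fs" using Cons.prems by auto
      then show ?thesis using True by (simp add: * r)
    next
      case False
      then have "(l, i) \<in> set fs" using Cons.prems by simp
      moreover from this have "l < fst f" using Cons.prems by force
      ultimately show ?thesis using Cons by (cases f) (auto simp: r)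
    qed
  qed simp
qed

text \<open>The common expansion determines the set of bases, strict decrease determines their
  order, and the multiplicities are the exponents.\<close>

lemma is_lyndon_factorization_unique:
  assumes "is_lyndon_factorization w fs" "is_lyndon_factorization w gs"
  shows "fs = gs"
proof -
  have e: "expand fs = expand gs"
    using lyndon_list_unique lyndon_list_expand assms by metis
  have f: "fs = map (\<lambda>l. (l, count_list (expand fs) l)) (map fst fs)"
    if "is_lyndon_factorization w fs" for fs
    using that by (auto simp: is_lyndon_factorization_def count_expand map_idI intro!: map_idI[symmetric])
  have set: "set (expand fs) = fst ` set fs" if "is_lyndon_factorization w fs" for fs
    using that by (intro set_expand) (auto simp: is_lyndon_factorization_def)
  have "set (map fst fs) = set (map fst gs)"
    using e set[OF assms(1)] set[OF assms(2)] by simp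
  then have "map fst fs = map fst gs"
    using assms strict_sorted_equal[of "rev (map fst fs)" "rev (map fst gs)"]
    by (simp add: is_lyndon_factorization_def sorted_wrt_rev)
  then show ?thesis using f assms e by metis
qed

lemma lyndon_factorization:
  assumes "lyndon_list ms"
  shows "expand (lyndon_factorization (concat ms)) = ms"
proof -
  obtain fs where fs: "is_lyndon_factorization (concat ms) fs" "expand fs = ms"
    using factorization_of_lyndon_list[OF assms] by blast
  then have "lyndon_factorization (concat ms) = fs"
    unfolding lyndon_factorization_def by (blast intro: is_lyndon_factorization_unique)
  then show ?thesis using fs by simp
qed

lemma Pi_word_concat:
  assumes "lyndon_list ms"
  shows "Pi_word q (concat ms) = prod_list (map (Pi_lyndon q) ms)"
proof -
  have "prod_list (map (\<lambda>(l, i). Pi_lyndon q l ^ i) fs) = prod_list (map (Pi_lyndon q) (expand fs))" for fs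
    by (induction fs) (auto simp: prod_list_replicate)
  then show ?thesis by (simp add: Pi_word_def lyndon_factorization assms)
qed

section \<open>The coproduct dual to the stuffle product\<close>

text \<open>Comparing sums over the supports of \<open>P\<close>, \<open>R\<close> and
  \<open>P + R\<close> requires a common index set. Leaving the summand \<open>g\<close> abstract
  serves linear maps, pairings and the stuffle product alike.\<close>

lemma sum_keys_superset:
  assumes "finite A" "Poly_Mapping.keys P \<subseteq> A" "\<And>w. g w 0 = 0"
  shows "(\<Sum>w\<in>Poly_Mapping.keys P. g w (Poly_Mapping.lookup P w)) = (\<Sum>w\<in>A. g w (Poly_Mapping.lookup P w))"
  using assms by (intro sum.mono_neutral_left) (auto simp: in_keys_iff)

lemma sum_single_lookup: "(\<Sum>w\<in>Poly_Mapping.keys P. Poly_Mapping.single w (Poly_Mapping.lookup P w)) = P"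
  by (rule poly_mapping_eqI) (auto simp: lookup_sum lookup_single when_def in_keys_iff)

lemma lookup_single_mult:
  fixes a :: "'b::semiring_0"
  shows "Poly_Mapping.lookup (Poly_Mapping.single k a * F) z =
    a * (\<Sum>x. Poly_Mapping.lookup F x when z = k + x)"
proof -
  have "Poly_Mapping.lookup (Poly_Mapping.single k a * F) z =
    (\<Sum>l. (a * (\<Sum>x. Poly_Mapping.lookup F x when z = l + x)) when k = l)"
    by (simp add: lookup_mult lookup_single when_mult)
  then show ?thesis by simp
qed

lemma lookup_single_mult_zero:
  fixes a :: "'b::semiring_0"
  shows "(\<And>x. z \<noteq> k + x) \<Longrightarrow> Poly_Mapping.lookup (Poly_Mapping.single k a * F) z = 0"
  by (simp add: lookup_single_mult)

lemma lookup_single_mult_cancel: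
  fixes a :: "'b::semiring_0"
  assumes "\<And>x. k + z = k + x \<longleftrightarrow> z = x"
  shows "Poly_Mapping.lookup (Poly_Mapping.single k a * F) (k + z) = a * Poly_Mapping.lookup F z"
  by (simp add: lookup_single_mult assms)

lemma lookup_single_0_mult:
  fixes c :: "'b::semiring_0"
  shows "Poly_Mapping.lookup (Poly_Mapping.single 0 c * F) z = c * Poly_Mapping.lookup F z"
  using lookup_single_mult_cancel[of 0 z c F] by simp

lemma single_mult_central:
  fixes c :: "'b::comm_semiring_0"
  shows "Poly_Mapping.single 0 c * F = F * Poly_Mapping.single 0 c"
proof -
  have "Poly_Mapping.single 0 c * (\<Sum>w\<in>A. Poly_Mapping.single w (f w)) =
    (\<Sum>w\<in>A. Poly_Mapping.single w (f w)) * Poly_Mapping.single 0 c" for f :: "'a \<Rightarrow> 'b" and A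
    by (simp add: sum_distrib_left sum_distrib_right mult_single mult.commute)
  from this[of "Poly_Mapping.lookup F" "Poly_Mapping.keys F"] show ?thesis
    unfolding sum_single_lookup .
qed

text \<open>Scalars enter as constants \<open>single 0 c\<close> of the target algebra, so that ring
  laws and the centrality of these constants take the place of module laws.\<close>

definition lin :: "('a \<Rightarrow> 'b \<Rightarrow>\<^sub>0 'k) \<Rightarrow> ('a \<Rightarrow>\<^sub>0 'k) \<Rightarrow> 'b::monoid_add \<Rightarrow>\<^sub>0 'k::comm_ring_1" where
  "lin h P = (\<Sum>w\<in>Poly_Mapping.keys P. Poly_Mapping.single 0 (Poly_Mapping.lookup P w) * h w)"

lemma lin_superset:
  assumes "finite A" "Poly_Mapping.keys P \<subseteq> A"
  shows "lin h P = (\<Sum>w\<in>A. Poly_Mapping.single 0 (Poly_Mapping.lookup P w) * h w)"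
  unfolding lin_def
  by (rule sum_keys_superset[OF assms, where g = "\<lambda>w c. Poly_Mapping.single 0 c * h w"]) simp

lemma lin_zero [simp]: "lin h 0 = 0"
  by (simp add: lin_def)

lemma lin_single: "lin h (Poly_Mapping.single w c) = Poly_Mapping.single 0 c * h w"
  by (subst lin_superset[of "{w}"]) (auto simp: lookup_single when_def split: if_splits)

lemma lin_add: "lin h (P + R) = lin h P + lin h R"
proof -
  let ?A = "Poly_Mapping.keys P \<union> Poly_Mapping.keys R"
  have "lin h F = (\<Sum>w\<in>?A. Poly_Mapping.single 0 (Poly_Mapping.lookup F w) * h w)"
    if "F \<in> {P, R, P + R}" for F
    using that keys_add[of P R] by (intro lin_superset) auto
  then show ?thesis by (simp add: lookup_add single_add distrib_right sum.distrib)
qed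

lemma lin_diff: "lin h (P - R) = lin h P - lin h R"
  using lin_add[of h "P - R" R] by (simp add: algebra_simps)

lemma lin_sum: "lin h (\<Sum>i\<in>A. f i) = (\<Sum>i\<in>A. lin h (f i))"
  by (induction A rule: infinite_finite_induct) (auto simp: lin_add)

lemma lin_one: "h 0 = 1 \<Longrightarrow> lin h 1 = 1"
  using lin_single[of h 0 1] by simp

lemma lin_mult:
  assumes "\<And>u v. h (u + v) = h u * h v"
  shows "lin h (P * R) = lin h P * lin h R"
proof -
  let ?s = "\<lambda>F w. Poly_Mapping.single w (Poly_Mapping.lookup F w)"
  let ?c = "\<lambda>F w. Poly_Mapping.single 0 (Poly_Mapping.lookup F w)"
  have "P * R = (\<Sum>u\<in>Poly_Mapping.keys P. \<Sum>v\<in>Poly_Mapping.keys R. ?s P u * ?s R v)"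
    by (simp add: sum_single_lookup flip: sum_product)
  moreover have "lin h (?s P u * ?s R v) = (?c P u * h u) * (?c R v * h v)" for u v
  proof -
    have "lin h (?s P u * ?s R v) = ?c P u * (?c R v * h u) * h v"
      by (simp add: mult_single lin_single assms flip: mult.assoc)
    also have "?c R v * h u = h u * ?c R v" by (rule single_mult_central)
    finally show ?thesis by (simp add: mult.assoc)
  qed
  ultimately show ?thesis by (simp add: lin_sum) (simp add: lin_def sum_product)
qed

section \<open>The tensor square and the coproduct\<close>

text \<open>Pairs of words form a monoid under componentwise concatenation; its monoid algebra is
  the tensor square with the usual product.\<close>

type_synonym 'k tensor = "(word \<times> word) \<Rightarrow>\<^sub>0 'k"

definition tensor_left :: "'k::comm_ring_1 ncpoly \<Rightarrow> 'k tensor" where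
  "tensor_left = lin (\<lambda>w. Poly_Mapping.single (w, []) 1)"

definition tensor_right :: "'k::comm_ring_1 ncpoly \<Rightarrow> 'k tensor" where
  "tensor_right = lin (\<lambda>w. Poly_Mapping.single ([], w) 1)"

text \<open>Dual to the three ways in which a letter of a stuffle product arises: from the left
  word, from the right word, or by merging two letters whose indices add up.\<close>

definition coprod_letter :: "'k::comm_ring_1 \<Rightarrow> letter \<Rightarrow> 'k tensor" where
  "coprod_letter q c = Poly_Mapping.single ([c], []) 1 + Poly_Mapping.single ([], [c]) 1
     + (\<Sum>i\<in>{1..<index c}. Poly_Mapping.single ([y i], [y (index c - i)]) q)"

definition coprod :: "'k::comm_ring_1 \<Rightarrow> 'k ncpoly \<Rightarrow> 'k tensor" where
  "coprod q = lin (\<lambda>w. prod_list (map (coprod_letter q) w))"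

lemma Nil_pair_eq_0: "([], []) = (0 :: 'a list \<times> 'b list)"
  by (simp add: zero_prod_def zero_list_def)

lemma plus_pair: "(a, b) + (u, v) = (a @ u, b @ v)"
  by (simp add: plus_prod_def plus_list_def)

lemma tensor_left_mult: "tensor_left (P * R) = tensor_left P * tensor_left R"
  unfolding tensor_left_def by (rule lin_mult) (simp add: mult_single plus_pair plus_list_def)

lemma tensor_right_mult: "tensor_right (P * R) = tensor_right P * tensor_right R"
  unfolding tensor_right_def by (rule lin_mult) (simp add: mult_single plus_pair plus_list_def)

lemma coprod_mult: "coprod q (P * R) = coprod q P * coprod q R"
  unfolding coprod_def by (rule lin_mult) (simp add: plus_list_def)

lemma tensor_left_one [simp]: "tensor_left 1 = 1"
  unfolding tensor_left_def by (rule lin_one) (simp add: zero_list_def Nil_pair_eq_0)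

lemma tensor_right_one [simp]: "tensor_right 1 = 1"
  unfolding tensor_right_def by (rule lin_one) (simp add: zero_list_def Nil_pair_eq_0)

lemma coprod_one [simp]: "coprod q 1 = 1"
  unfolding coprod_def by (rule lin_one) (simp add: zero_list_def)

lemma tensor_left_alt:
  "tensor_left P = (\<Sum>w\<in>Poly_Mapping.keys P. Poly_Mapping.single (w, []) (Poly_Mapping.lookup P w))"
  by (simp add: tensor_left_def lin_def mult_single)

lemma tensor_right_alt:
  "tensor_right P = (\<Sum>w\<in>Poly_Mapping.keys P. Poly_Mapping.single ([], w) (Poly_Mapping.lookup P w))"
  by (simp add: tensor_right_def lin_def mult_single)

lemma tensor_left_right_commute: "tensor_left P * tensor_right R = tensor_right R * tensor_left P"
proof -
  have "tensor_right R * tensor_left P = (\<Sum>u\<in>Poly_Mapping.keys P. \<Sum>v\<in>Poly_Mapping.keys R.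
    Poly_Mapping.single (u, v) (Poly_Mapping.lookup P u * Poly_Mapping.lookup R v))"
    unfolding tensor_left_alt tensor_right_alt sum_product
    by (subst sum.swap) (simp add: mult_single plus_pair plus_list_def mult.commute)
  then show ?thesis
    by (simp add: tensor_left_alt tensor_right_alt sum_product mult_single plus_pair plus_list_def)
qed

lemma lookup_tensor:
  "Poly_Mapping.lookup (tensor_left P * tensor_right R) (u, v) =
     Poly_Mapping.lookup P u * Poly_Mapping.lookup R v"
proof -
  have "Poly_Mapping.lookup (tensor_left P * tensor_right R) (u, v) =
    (\<Sum>u'\<in>Poly_Mapping.keys P. \<Sum>v'\<in>Poly_Mapping.keys R.
      if v = v' then if u = u' then Poly_Mapping.lookup P u' * Poly_Mapping.lookup R v' else 0 else 0)"
    unfolding tensor_left_alt tensor_right_alt sum_product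
    by (auto simp: mult_single plus_pair plus_list_def lookup_sum lookup_single when_def intro!: sum.cong)
  then show ?thesis
    by (cases "u \<in> Poly_Mapping.keys P"; cases "v \<in> Poly_Mapping.keys R") (auto simp: in_keys_iff)
qed

lemma lookup_mon: "Poly_Mapping.lookup (mon u) w = (if u = w then 1 else 0)"
  by (simp add: mon_def lookup_single when_def)

lemma lookup_mon_Cons_mult:
  "Poly_Mapping.lookup (mon [a] * F) (c # w) = (if a = c then Poly_Mapping.lookup F w else 0)"
proof -
  have "Poly_Mapping.lookup (mon [a] * F) ([a] + w) = Poly_Mapping.lookup F w"
    unfolding mon_def by (subst lookup_single_mult_cancel) (auto simp: plus_list_def)
  moreover have "Poly_Mapping.lookup (mon [a] * F) (c # w) = 0" if "a \<noteq> c"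
    unfolding mon_def using that by (intro lookup_single_mult_zero) (auto simp: plus_list_def)
  ultimately show ?thesis by (auto simp: plus_list_def)
qed

lemma lookup_mon_Nil_mult: "Poly_Mapping.lookup (mon [a] * F) [] = 0"
  unfolding mon_def by (intro lookup_single_mult_zero) (auto simp: plus_list_def)

lemma lookup_pair_mult:
  "Poly_Mapping.lookup (Poly_Mapping.single (x, z) c * F) (u, v) =
    (if take (length x) u = x \<and> take (length z) v = z
     then c * Poly_Mapping.lookup F (drop (length x) u, drop (length z) v) else 0)"
proof (cases "take (length x) u = x \<and> take (length z) v = z")
  case True
  then have "(u, v) = (x, z) + (drop (length x) u, drop (length z) v)"
    by (metis append_take_drop_id plus_pair)
  moreover have "Poly_Mapping.lookup (Poly_Mapping.single (x, z) c * F)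
    ((x, z) + (drop (length x) u, drop (length z) v)) =
    c * Poly_Mapping.lookup F (drop (length x) u, drop (length z) v)"
    by (rule lookup_single_mult_cancel) (auto simp: plus_list_def)
  ultimately show ?thesis using True by simp
next
  case False
  then have "(u, v) \<noteq> (x, z) + r" for r by (cases r) (auto simp: plus_list_def)
  then have "Poly_Mapping.lookup (Poly_Mapping.single (x, z) c * F) (u, v) = 0"
    by (rule lookup_single_mult_zero)
  then show ?thesis using False by auto
qed

lemma index_pos: "1 \<le> index a"
  using index[of a] by simp

lemma y_eq_iff: "1 \<le> i \<Longrightarrow> y i = a \<longleftrightarrow> i = index a"
  using y_inverse[of i] index_inverse[of a] by auto

lemma lookup_coprod_letter_mult:
  "Poly_Mapping.lookup (coprod_letter q c * F) (u, v) =
     (if take 1 u = [c] then Poly_Mapping.lookup F (tl u, v) else 0)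
   + (if take 1 v = [c] then Poly_Mapping.lookup F (u, tl v) else 0)
   + (if u \<noteq> [] \<and> v \<noteq> [] \<and> index (hd u) + index (hd v) = index c
      then q * Poly_Mapping.lookup F (tl u, tl v) else 0)"
proof -
  have "(\<Sum>i\<in>{1..<index c}. Poly_Mapping.lookup
      (Poly_Mapping.single ([y i], [y (index c - i)]) q * F) (u, v)) =
    (if u \<noteq> [] \<and> v \<noteq> [] \<and> index (hd u) + index (hd v) = index c
     then q * Poly_Mapping.lookup F (tl u, tl v) else 0)"
  proof (cases "u \<noteq> [] \<and> v \<noteq> []")
    case True
    then obtain a u' b v' where uv: "u = a # u'" "v = b # v'" by (meson list.exhaust)
    have "(\<Sum>i\<in>{1..<index c}. Poly_Mapping.lookup
      (Poly_Mapping.single ([y i], [y (index c - i)]) q * F) (u, v)) =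
      (\<Sum>i\<in>{1..<index c}. if i = index a
        then if index a + index b = index c then q * Poly_Mapping.lookup F (u', v') else 0 else 0)"
    proof (rule sum.cong)
      fix i assume i: "i \<in> {1..<index c}"
      then have "[a] = [y i] \<and> [b] = [y (index c - i)] \<longleftrightarrow> i = index a \<and> index a + index b = index c"
        using y_eq_iff[of i a] y_eq_iff[of "index c - i" b]
        by (simp add: eq_commute[of a] eq_commute[of b]) linarith
      then show "Poly_Mapping.lookup (Poly_Mapping.single ([y i], [y (index c - i)]) q * F) (u, v) =
        (if i = index a
        then if index a + index b = index c then q * Poly_Mapping.lookup F (u', v') else 0 else 0)"
        by (auto simp: lookup_pair_mult uv)
    qed simp
    then show ?thesis using index_pos[of a] index_pos[of b] by (auto simp: uv)
  qed (auto simp: lookup_pair_mult)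
  then show ?thesis
    by (simp add: coprod_letter_def distrib_right sum_distrib_right lookup_add lookup_sum
        lookup_pair_mult drop_Suc)
qed

lemma stuffle_words_Nil [simp]: "stuffle_words q [] v = mon v"
  by (cases v) simp_all

lemma take_1_eq: "take (Suc 0) u = [c] \<longleftrightarrow> (\<exists>v. u = c # v)"
  by (cases u) auto

text \<open>Adjointness on words. Removing the first letter of \<open>w\<close> from the product of
  coproducts removes a first letter from \<open>u\<close>, from \<open>v\<close> or from both, which
  is the recursion of \<open>stuffle_words\<close>.\<close>

lemma lookup_coprod_word:
  "Poly_Mapping.lookup (prod_list (map (coprod_letter q) w)) (u, v) =
     Poly_Mapping.lookup (stuffle_words q u v) w"
proof (induction w arbitrary: u v)
  case Nil
  show ?case
    by (cases "(q, u, v)" rule: stuffle_words.cases)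
      (auto simp: lookup_one when_def lookup_mon lookup_add lookup_smult lookup_mon_Nil_mult
        simp flip: Nil_pair_eq_0)
next
  case (Cons c w)
  have "y (index a + index b) = c \<longleftrightarrow> index a + index b = index c" for a b
    using y_eq_iff[of "index a + index b" c] index_pos[of a] by simp
  then show ?case
    by (cases "(q, u, v)" rule: stuffle_words.cases)
      (auto simp: lookup_coprod_letter_mult take_1_eq Cons.IH lookup_add lookup_smult lookup_mon_Cons_mult
        lookup_mon)
qed

section \<open>Adjointness and primitive elements\<close>

lemma pairing_superset:
  assumes "finite A" "Poly_Mapping.keys P \<subseteq> A"
  shows "pairing P R = (\<Sum>w\<in>A. Poly_Mapping.lookup P w * Poly_Mapping.lookup R w)"
  unfolding pairing_def
  by (rule sum_keys_superset[OF assms, where g = "\<lambda>w c. c * Poly_Mapping.lookup R w"]) simp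

lemma pairing_superset_right:
  assumes "finite A" "Poly_Mapping.keys R \<subseteq> A"
  shows "pairing P R = (\<Sum>w\<in>A. Poly_Mapping.lookup P w * Poly_Mapping.lookup R w)"
  unfolding pairing_superset[OF finite_UnI[OF finite_keys[of P] assms(1)] Un_upper1]
  using assms not_in_keys_iff_lookup_eq_zero[of _ R]
  by (intro sum.mono_neutral_right) (auto, metis mult_zero_right subsetD)

lemma pairing_commute: "pairing P R = pairing R P"
  using pairing_superset_right[of "Poly_Mapping.keys R" R P] by (simp add: pairing_def mult.commute)

lemma pairing_add_right: "pairing P (R + S) = pairing P R + pairing P S"
  by (simp add: pairing_def lookup_add distrib_left sum.distrib)

lemma pairing_add_left: "pairing (R + S) P = pairing R P + pairing S P"
  by (simp add: pairing_commute[of _ P] pairing_add_right)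

lemma pairing_diff_left: "pairing (R - S) P = pairing R P - pairing S P"
  using pairing_add_left[of "R - S" S P] by simp

lemma pairing_smult_left: "pairing (smult c P) R = c * pairing P R"
  using pairing_superset[OF finite_keys keys_smult, of c P R]
  by (simp add: pairing_def lookup_smult sum_distrib_left mult.assoc)

lemma pairing_sum_left: "pairing (\<Sum>i\<in>A. f i) P = (\<Sum>i\<in>A. pairing (f i) P)"
  by (induction A rule: infinite_finite_induct) (auto simp: pairing_add_left, simp_all add: pairing_def)

lemma lookup_coprod: "Poly_Mapping.lookup (coprod q P) (u, v) = pairing (stuffle_words q u v) P"
proof -
  have "Poly_Mapping.lookup (coprod q P) (u, v) =
    (\<Sum>w\<in>Poly_Mapping.keys P. Poly_Mapping.lookup P w * Poly_Mapping.lookup (stuffle_words q u v) w)"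
    by (simp add: coprod_def lin_def lookup_sum lookup_single_0_mult lookup_coprod_word)
  then show ?thesis unfolding pairing_commute[of "stuffle_words q u v"] by (simp add: pairing_def)
qed

lemma pairing_stuffle:
  "pairing (stuffle q S R) P = (\<Sum>u\<in>Poly_Mapping.keys S. \<Sum>v\<in>Poly_Mapping.keys R.
     Poly_Mapping.lookup S u * Poly_Mapping.lookup R v * Poly_Mapping.lookup (coprod q P) (u, v))"
  by (simp add: stuffle_def pairing_sum_left pairing_smult_left lookup_coprod)

definition primitive :: "'k::comm_ring_1 \<Rightarrow> 'k ncpoly \<Rightarrow> bool" where
  "primitive q P \<longleftrightarrow> coprod q P = tensor_left P + tensor_right P"

text \<open>Left and right tensors commute, so the mixed terms of \<open>coprod q (P * R)\<close>
  are symmetric in \<open>P\<close> and \<open>R\<close> and cancel in the commutator.\<close>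

lemma primitive_commutator:
  assumes "primitive q P" "primitive q R"
  shows "primitive q (P * R - R * P)"
proof -
  have d: "coprod q (A - B) = coprod q A - coprod q B" "tensor_left (A - B) = tensor_left A - tensor_left B"
    "tensor_right (A - B) = tensor_right A - tensor_right B" for A B :: "'a ncpoly"
    by (simp_all add: coprod_def tensor_left_def tensor_right_def lin_diff)
  show ?thesis using assms
    by (simp add: primitive_def d coprod_mult tensor_left_mult tensor_right_mult algebra_simps
        tensor_left_right_commute)
qed

section \<open>Distributing the entries of a list over two positions\<close>

text \<open>A list rather than a set, since equal entries make the same pair occur repeatedly, and
  these repetitions become the binomial coefficients.\<close>

fun splits :: "'a list \<Rightarrow> ('a list \<times> 'a list) list" where
  "splits [] = [([], [])]"
| "splits (x # xs) =
     map (\<lambda>(u, v). (x # u, v)) (splits xs) @ map (\<lambda>(u, v). (u, x # v)) (splits xs)"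

lemma coprod_prod_list:
  fixes f :: "'a \<Rightarrow> 'k::comm_ring_1 ncpoly"
  assumes "\<And>m. m \<in> set ms \<Longrightarrow> primitive q (f m)"
  shows "coprod q (prod_list (map f ms)) =
    (\<Sum>(u, v)\<leftarrow>splits ms. tensor_left (prod_list (map f u)) * tensor_right (prod_list (map f v)))"
  using assms
proof (induction ms)
  case (Cons m ms)
  let ?g = "\<lambda>(u, v). tensor_left (prod_list (map f u)) * tensor_right (prod_list (map f v))"
  have swap: "tensor_right P * (tensor_left A * B) = tensor_left A * (tensor_right P * B)"
    for P A :: "'k ncpoly" and B
    by (simp add: tensor_left_right_commute flip: mult.assoc)
  have "coprod q (prod_list (map f (m # ms))) =
    tensor_left (f m) * sum_list (map ?g (splits ms)) + tensor_right (f m) * sum_list (map ?g (splits ms))"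
    using Cons by (simp add: coprod_mult primitive_def distrib_right)
  also have "\<dots> = sum_list (map ?g (splits (m # ms)))"
    by (simp add: sum_list_const_mult[symmetric] o_def case_prod_unfold tensor_left_mult tensor_right_mult
        mult.assoc swap)
  finally show ?case .
qed simp

lemma pairing_stuffle_prod_list:
  fixes f :: "'b \<Rightarrow> 'k::comm_ring_1 ncpoly"
  assumes "\<And>m. m \<in> set ms \<Longrightarrow> primitive q (f m)"
  shows "pairing (stuffle q S R) (prod_list (map f ms)) =
    (\<Sum>(u, v)\<leftarrow>splits ms. pairing S (prod_list (map f u)) * pairing R (prod_list (map f v)))"
proof -
  have l: "Poly_Mapping.lookup (sum_list (map g xs)) k = (\<Sum>x\<leftarrow>xs. Poly_Mapping.lookup (g x) k)"
    for g :: "'b list \<times> 'b list \<Rightarrow> 'k tensor" and xs k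
    by (induction xs) (auto simp: lookup_add)
  have swap: "(\<Sum>u\<in>A. \<Sum>v\<in>B. c u v * (\<Sum>x\<leftarrow>xs. h x u v)) = (\<Sum>x\<leftarrow>xs. \<Sum>u\<in>A. \<Sum>v\<in>B. c u v * h x u v)"
    for A B c and h :: "'b list \<times> 'b list \<Rightarrow> word \<Rightarrow> word \<Rightarrow> 'k" and xs
    by (induction xs) (auto simp: distrib_left sum.distrib)
  have "pairing (stuffle q S R) (prod_list (map f ms)) =
    (\<Sum>(a, b)\<leftarrow>splits ms. \<Sum>u\<in>Poly_Mapping.keys S. \<Sum>v\<in>Poly_Mapping.keys R.
      Poly_Mapping.lookup S u * Poly_Mapping.lookup R v *
      (Poly_Mapping.lookup (prod_list (map f a)) u * Poly_Mapping.lookup (prod_list (map f b)) v))"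
    by (simp add: pairing_stuffle coprod_prod_list[OF assms] l case_prod_unfold lookup_tensor swap)
  also have "\<dots> = (\<Sum>(u, v)\<leftarrow>splits ms. pairing S (prod_list (map f u)) * pairing R (prod_list (map f v)))"
    unfolding pairing_def sum_product by (simp add: mult_ac)
  finally show ?thesis .
qed

lemma splits_sorted:
  assumes "(u, v) \<in> set (splits ms)"
  shows "set u \<subseteq> set ms" "set v \<subseteq> set ms" "sorted_wrt r ms \<Longrightarrow> sorted_wrt r u" "sorted_wrt r ms \<Longrightarrow> sorted_wrt r v"
proof -
  have "set u \<subseteq> set ms \<and> set v \<subseteq> set ms \<and> (sorted_wrt r ms \<longrightarrow> sorted_wrt r u \<and> sorted_wrt r v)"
    using assms by (induction ms arbitrary: u v) force+
  then show "set u \<subseteq> set ms" "set v \<subseteq> set ms" "sorted_wrt r ms \<Longrightarrow> sorted_wrt r u" "sorted_wrt r ms \<Longrightarrow> sorted_wrt r v"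
    by auto
qed

lemma count_list_map_fst:
  "count_list (map (\<lambda>(u, v). (x # u, v)) xs) (a, b) =
     (if a \<noteq> [] \<and> hd a = x then count_list xs (tl a, b) else 0)"
  by (induction xs) (auto simp: neq_Nil_conv)

lemma count_list_map_snd:
  "count_list (map (\<lambda>(u, v). (u, x # v)) xs) (a, b) =
     (if b \<noteq> [] \<and> hd b = x then count_list xs (a, tl b) else 0)"
  by (induction xs) (auto simp: neq_Nil_conv)

lemma count_list_splits_Cons:
  "count_list (splits (m # ms)) (a, b) =
     (if a \<noteq> [] \<and> hd a = m then count_list (splits ms) (tl a, b) else 0)
   + (if b \<noteq> [] \<and> hd b = m then count_list (splits ms) (a, tl b) else 0)"
  by (simp add: count_list_map_fst count_list_map_snd)

text \<open>This count is the value at \<open>\<Pi>\<^sub>w\<close>, \<open>w = concat ms\<close>, of the stuffle product of the dual elements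
  of the power \<open>l\<^sup>i\<close> and of \<open>concat ns\<close>.\<close>

lemma count_list_splits_replicate:
  assumes "sorted_wrt (\<ge>) ms" "\<forall>n\<in>set ns. n \<le> (l :: 'a::linorder)"
  shows "count_list (splits ms) (replicate i l, ns) =
    (if ms = replicate i l @ ns then (i + count_list ns l) choose i else 0)"
  using assms
proof (induction ms arbitrary: i ns)
  case Nil
  then show ?case by (auto simp: eq_commute[of _ ns])
next
  case (Cons m ms)
  have sorted: "sorted_wrt (\<ge>) ms" "\<forall>x\<in>set ms. x \<le> m" using Cons.prems by auto
  show ?case
  proof (cases i)
    case 0
    then show ?thesis
      using Cons.IH[OF sorted(1), of "tl ns" 0] Cons.prems
      by (cases ns) (auto simp: count_list_splits_Cons simp del: splits.simps(2))
  next
    case (Suc j)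
    have fst: "count_list (splits ms) (replicate j l, ns) =
      (if ms = replicate j l @ ns then (j + count_list ns l) choose j else 0)"
      by (rule Cons.IH) (use sorted Cons.prems in auto)
    have snd: "count_list (splits ms) (replicate i l, tl ns) =
      (if ms = replicate i l @ tl ns then (i + count_list (tl ns) l) choose i else 0)"
    proof (rule Cons.IH)
      show "\<forall>n\<in>set (tl ns). n \<le> l" using Cons.prems by (cases ns) auto
    qed (fact sorted)
    have step: "count_list (splits (m # ms)) (replicate i l, ns) =
      (if l = m then count_list (splits ms) (replicate j l, ns) else 0) +
      (if ns \<noteq> [] \<and> hd ns = m then count_list (splits ms) (replicate i l, tl ns) else 0)"
      unfolding count_list_splits_Cons by (simp add: Suc)
    show ?thesis
    proof (cases "m = l")
      case True
      \<comment> \<open>If \<open>ns\<close> starts with \<open>l\<close>, Pascal's rule adds the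
        two contributions. Otherwise only the first one is present, \<open>l\<close> does not occur
        in \<open>ns\<close> by monotonicity, and both binomial coefficients are 1.\<close>
      have "count_list ns l = 0" if "ns = [] \<or> hd ns \<noteq> l" "ms = replicate j l @ ns"
      proof -
        have "\<forall>n\<in>set ns. n \<le> hd ns"
          using sorted that by (cases ns) (auto simp: sorted_wrt_append)
        with that Cons.prems(2) show ?thesis
          by (cases ns) (auto simp: count_list_0_iff)
      qed
      moreover have "l # replicate j l @ tl ns = replicate j l @ ns" if "ns \<noteq> []" "hd ns = l"
        using that by (cases ns) (auto simp: replicate_app_Cons_same)
      ultimately show ?thesis using True Suc
        unfolding step fst snd by (cases ns) (auto simp: replicate_app_Cons_same)
    next
      case False
      \<comment> \<open>Since \<open>i > 0\<close>, an \<open>l\<close> would remain in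
        \<open>ms\<close>, forcing \<open>l \<le> m \<le> l\<close>.\<close>
      have "\<not> (ns \<noteq> [] \<and> hd ns = m \<and> ms = replicate i l @ tl ns)"
      proof
        assume *: "ns \<noteq> [] \<and> hd ns = m \<and> ms = replicate i l @ tl ns"
        then have "l \<le> m" using sorted Suc by auto
        moreover have "m \<le> l" using Cons.prems(2) * by auto
        ultimately show False using False by simp
      qed
      then show ?thesis using False Suc unfolding step snd by auto
    qed
  qed
qed

section \<open>Primitive elements\<close>

lemma of_Q_0 [simp]: "of_Q 0 = 0"
  using of_Q_add[of 0 0] by simp

lemma of_Q_of_nat: "of_Q (of_nat n) = of_nat n"
  by (induction n) (simp_all add: of_Q_add of_Q_1)

text \<open>\<open>quasi_shuffle_sum g a b\<close> sums \<open>g (length w)\<close> over the words \<open>w\<close> occurring in the stuffle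
  product, at \<open>q = 1\<close>, of words of lengths \<open>a\<close> and \<open>b\<close>.\<close>

fun quasi_shuffle_sum :: "(nat \<Rightarrow> rat) \<Rightarrow> nat \<Rightarrow> nat \<Rightarrow> rat" where
  "quasi_shuffle_sum g a 0 = g a"
| "quasi_shuffle_sum g 0 b = g b"
| "quasi_shuffle_sum g (Suc a) (Suc b) =
     quasi_shuffle_sum (\<lambda>n. g (Suc n)) a (Suc b) + quasi_shuffle_sum (\<lambda>n. g (Suc n)) (Suc a) b
     + quasi_shuffle_sum (\<lambda>n. g (Suc n)) a b"

lemma quasi_shuffle_sum_0 [simp]: "quasi_shuffle_sum g 0 b = g b"
  by (cases b) simp_all

lemma quasi_shuffle_sum_add:
  "quasi_shuffle_sum (\<lambda>n. g n + h n) a b = quasi_shuffle_sum g a b + quasi_shuffle_sum h a b"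
  by (induction g a b arbitrary: h rule: quasi_shuffle_sum.induct) simp_all

lemma quasi_shuffle_sum_mult: "quasi_shuffle_sum (\<lambda>n. c * g n) a b = c * quasi_shuffle_sum g a b"
  by (induction g a b rule: quasi_shuffle_sum.induct) (simp_all add: distrib_left)

text \<open>A quasi-shuffle is at least as long as the second word, so smaller arguments of
  \<open>g\<close> never occur.\<close>

lemma quasi_shuffle_sum_cong:
  "(\<And>n. b \<le> n \<Longrightarrow> g n = h n) \<Longrightarrow> quasi_shuffle_sum g a b = quasi_shuffle_sum h a b"
proof (induction g a b arbitrary: h rule: quasi_shuffle_sum.induct)
  case (3 g a b)
  have "quasi_shuffle_sum (\<lambda>n. g (Suc n)) a (Suc b) = quasi_shuffle_sum (\<lambda>n. h (Suc n)) a (Suc b)"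
    "quasi_shuffle_sum (\<lambda>n. g (Suc n)) (Suc a) b = quasi_shuffle_sum (\<lambda>n. h (Suc n)) (Suc a) b"
    "quasi_shuffle_sum (\<lambda>n. g (Suc n)) a b = quasi_shuffle_sum (\<lambda>n. h (Suc n)) a b"
    by (intro 3; simp add: 3)+
  then show ?case by simp
qed simp_all

text \<open>Applied to \<open>g n = z choose n\<close>, the recurrence is the identity
  \<open>(a + 1) (z choose (a + 1)) = (z - a) (z choose a)\<close> expanded in the basis of binomial coefficients.\<close>

lemma quasi_shuffle_sum_Suc:
  "(of_nat a + 1) * quasi_shuffle_sum g (Suc a) b =
     quasi_shuffle_sum (\<lambda>n. (of_nat n + 1) * g (Suc n) + (of_nat n - of_nat a) * g n) a b"
proof (induction "a + b" arbitrary: a b g rule: less_induct)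
  case less
  let ?T = "\<lambda>a g n. (of_nat n + 1) * g (Suc n) + (of_nat n - of_nat a :: rat) * g n"
  have IH: "quasi_shuffle_sum (?T a' g') a' b' = (of_nat a' + 1) * quasi_shuffle_sum g' (Suc a') b'"
    if "a' + b' < a + b" for a' b' g'
    using less[OF that] by simp
  show ?case
  proof (cases b)
    case (Suc b')
    let ?S = "\<lambda>n. g (Suc n)" and ?SS = "\<lambda>n. g (Suc (Suc n))"
    show ?thesis
    proof (cases a)
      case 0
      then show ?thesis using IH[of 0 b' ?S] by (simp add: Suc algebra_simps)
    next
      case (Suc a')
      \<comment> \<open>Shifting the argument by one reproduces the operator for \<open>a'\<close>
        with one extra term, or the one for \<open>a\<close> with two; the induction hypothesis
        applies to the operator part.\<close>
      have 1: "(\<lambda>n. ?T a g (Suc n)) = (\<lambda>n. ?T a' ?S n + ?SS n)"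
        by (auto simp: Suc algebra_simps)
      have 2: "(\<lambda>n. ?T a g (Suc n)) = (\<lambda>n. ?T a ?S n + (?S n + ?SS n))"
        by (auto simp: Suc algebra_simps)
      have "quasi_shuffle_sum (?T a g) a b = quasi_shuffle_sum (\<lambda>n. ?T a g (Suc n)) a' b
        + quasi_shuffle_sum (\<lambda>n. ?T a g (Suc n)) a b' + quasi_shuffle_sum (\<lambda>n. ?T a g (Suc n)) a' b'"
        by (simp only: Suc \<open>b = Suc b'\<close> quasi_shuffle_sum.simps)
      also have "quasi_shuffle_sum (\<lambda>n. ?T a g (Suc n)) a' b =
        of_nat a * quasi_shuffle_sum ?S a b + quasi_shuffle_sum ?SS a' b"
        unfolding 1 by (subst quasi_shuffle_sum_add, subst IH) (simp_all add: Suc add.commute)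
      also have "quasi_shuffle_sum (\<lambda>n. ?T a g (Suc n)) a' b' =
        of_nat a * quasi_shuffle_sum ?S a b' + quasi_shuffle_sum ?SS a' b'"
        unfolding 1 by (subst quasi_shuffle_sum_add, subst IH) (simp_all add: Suc \<open>b = Suc b'\<close> add.commute)
      also have "quasi_shuffle_sum (\<lambda>n. ?T a g (Suc n)) a b' =
        (of_nat a + 1) * quasi_shuffle_sum ?S (Suc a) b'
        + (quasi_shuffle_sum ?S a b' + quasi_shuffle_sum ?SS a b')"
        unfolding 2 by (subst quasi_shuffle_sum_add, subst IH, simp add: \<open>b = Suc b'\<close>)
          (simp add: quasi_shuffle_sum_add)
      \<comment> \<open>The three sums over \<open>?SS\<close> make up
        \<open>quasi_shuffle_sum ?S a b\<close> by its recursion, which raises the factor of that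
        sum from \<open>a\<close> to \<open>a + 1\<close>.\<close>
      finally show ?thesis by (simp add: Suc \<open>b = Suc b'\<close> algebra_simps)
    qed
  qed simp
qed

text \<open>The derivative of \<open>z choose n\<close> at \<open>z = 0\<close>; division by zero
  gives the right value 0 at \<open>n = 0\<close>.\<close>

definition log_coeff :: "nat \<Rightarrow> rat" where
  "log_coeff n = (-1) ^ (n - 1) / of_nat n"

text \<open>This is the double zero of \<open>(z choose (a + 1)) (z choose (b + 1))\<close> at
  \<open>z = 0\<close>. In terms of the recurrence, the sum for \<open>a + 1\<close> is a multiple
  of \<open>a\<close> times the sum for \<open>a\<close>, so it vanishes at the start and stays
  zero.\<close>

lemma quasi_shuffle_sum_log_coeff: "quasi_shuffle_sum log_coeff (Suc a) (Suc b) = 0"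
proof (induction a)
  have *: "(of_nat n + 1) * log_coeff (Suc n) + (of_nat n - of_nat a) * log_coeff n =
    - of_nat a * log_coeff n" if "1 \<le> n" for n a
  proof -
    have "(of_nat n + 1) * log_coeff (Suc n) + of_nat n * log_coeff n = 0"
      using that by (cases n) (simp_all add: log_coeff_def add_eq_0_iff)
    then show ?thesis by (simp add: left_diff_distrib)
  qed
  \<comment> \<open>The second length is positive, so only \<open>n \<ge> 1\<close> matters; at
    \<open>n = 0\<close> the relation just proved fails.\<close>
  have step: "(of_nat a + 1) * quasi_shuffle_sum log_coeff (Suc a) (Suc b) =
    - of_nat a * quasi_shuffle_sum log_coeff a (Suc b)" for a
    by (subst quasi_shuffle_sum_Suc, subst quasi_shuffle_sum_mult[symmetric],
        rule quasi_shuffle_sum_cong) (simp add: *)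
  case 0
  show ?case using step[of 0] by simp
  case (Suc a)
  show ?case using step[of "Suc a"] Suc by (simp add: add_nonneg_eq_0_iff)
qed

section \<open>Linear forms depending on the length, evaluated on stuffle products\<close>

text \<open>A separate notion from \<open>pairing\<close>, because functions of the length are not
  finitely supported.\<close>

definition evalf :: "('a \<Rightarrow> 'k) \<Rightarrow> ('a \<Rightarrow>\<^sub>0 'k) \<Rightarrow> 'k::comm_ring_1" where
  "evalf f P = (\<Sum>w\<in>Poly_Mapping.keys P. Poly_Mapping.lookup P w * f w)"

lemma evalf_superset:
  assumes "finite A" "Poly_Mapping.keys P \<subseteq> A"
  shows "evalf f P = (\<Sum>w\<in>A. Poly_Mapping.lookup P w * f w)"
  unfolding evalf_def by (rule sum_keys_superset[OF assms, where g = "\<lambda>w c. c * f w"]) simp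

lemma evalf_add: "evalf f (P + R) = evalf f P + evalf f R"
proof -
  let ?A = "Poly_Mapping.keys P \<union> Poly_Mapping.keys R"
  have "evalf f F = (\<Sum>w\<in>?A. Poly_Mapping.lookup F w * f w)" if "F \<in> {P, R, P + R}" for F
    using that keys_add[of P R] by (intro evalf_superset) auto
  then show ?thesis by (simp add: lookup_add distrib_right sum.distrib)
qed

lemma evalf_smult: "evalf f (smult c P) = c * evalf f P"
  using evalf_superset[OF finite_keys keys_smult, of f c P]
  by (simp add: evalf_def lookup_smult sum_distrib_left mult.assoc)

lemma evalf_scale: "evalf (\<lambda>w. c * f w) P = c * evalf f P"
  by (simp add: evalf_def sum_distrib_left mult_ac)

lemma evalf_mon: "evalf f (mon w) = f w"
  by (simp add: evalf_def keys_mon lookup_mon)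

lemma evalf_mon_mult: "evalf f (mon [a] * P) = evalf (\<lambda>w. f (a # w)) P"
proof -
  have "Poly_Mapping.keys (mon [a] * P) \<subseteq> Cons a ` Poly_Mapping.keys P"
    using keys_mult[of "mon [a]" P] by (auto simp: keys_mon plus_list_def)
  then have "evalf f (mon [a] * P) =
    (\<Sum>w\<in>Cons a ` Poly_Mapping.keys P. Poly_Mapping.lookup (mon [a] * P) w * f w)"
    by (intro evalf_superset) simp_all
  then show ?thesis by (simp add: sum.reindex evalf_def lookup_mon_Cons_mult)
qed

text \<open>Every merger of two letters shortens the word by one and contributes one
  \<open>q\<close>, so the weight \<open>q ^ length w\<close> completes each term to the same power
  of \<open>q\<close>.\<close>

lemma evalf_stuffle_words:
  "evalf (\<lambda>w. q ^ length w * of_Q (g (length w))) (stuffle_words q u v) =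
     q ^ (length u + length v) * of_Q (quasi_shuffle_sum g (length u) (length v))"
proof (induction q u v arbitrary: g rule: stuffle_words.induct)
  case (3 q a u b v)
  have *: "evalf (\<lambda>w. q ^ length w * of_Q (g (length w))) (mon [c] * P) =
    q * evalf (\<lambda>w. q ^ length w * of_Q (g (Suc (length w)))) P" for c and P :: "'a ncpoly"
    by (simp add: evalf_mon_mult mult.assoc flip: evalf_scale)
  show ?case
    unfolding stuffle_words.simps evalf_add evalf_smult * "3.IH"[of "\<lambda>n. g (Suc n)"]
    by (simp add: of_Q_add algebra_simps)
qed (simp_all add: evalf_mon)

text \<open>The lower exponent is obtained without dividing by \<open>q\<close>: after the first
  letter is split off, \<open>length w - 1\<close> is the length of the remaining word, to which the
  previous evaluation applies.\<close>

lemma evalf_log_stuffle_words: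
  assumes "u \<noteq> []" "v \<noteq> []"
  shows "evalf (\<lambda>w. q ^ (length w - 1) * of_Q (log_coeff (length w))) (stuffle_words q u v) = 0"
proof -
  obtain a u' b v' where uv: "u = a # u'" "v = b # v'" using assms by (meson list.exhaust)
  have "evalf (\<lambda>w. q ^ (length w - 1) * of_Q (log_coeff (length w))) (stuffle_words q u v) =
    q ^ (length u' + length v) * of_Q (quasi_shuffle_sum log_coeff (length u) (length v))"
    using evalf_stuffle_words[of q "\<lambda>n. log_coeff (Suc n)"]
    by (simp add: uv evalf_add evalf_smult evalf_mon_mult of_Q_add algebra_simps)
  then show ?thesis by (simp add: uv quasi_shuffle_sum_log_coeff del: quasi_shuffle_sum.simps)
qed

section \<open>The element \<open>pi1\<close> at a letter\<close>

lemma lookup_stuffle_words_letter: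
  "Poly_Mapping.lookup (stuffle_words q u v) [a] =
     (if u = [a] \<and> v = [] \<or> u = [] \<and> v = [a] then 1
      else if \<exists>b c. u = [b] \<and> v = [c] \<and> index b + index c = index a then q else 0)"
proof -
  have *: "Poly_Mapping.lookup (stuffle_words q u v) [a] = Poly_Mapping.lookup (coprod_letter q a * 1) (u, v)"
    using lookup_coprod_word[of q "[a]" u v] by simp
  show ?thesis
    unfolding * lookup_coprod_letter_mult using index_pos[of "hd u"] index_pos[of "hd v"]
    by (cases u; cases v) (auto simp: lookup_one when_def simp flip: Nil_pair_eq_0)
qed

lemma weight_eq_0: "weight w = 0 \<longleftrightarrow> w = []"
  using index_pos[of "hd w"] by (cases w) (auto simp: weight_def)

lemma weight_append: "weight (u @ v) = weight u + weight v"
  by (simp add: weight_def)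

text \<open>A product of nonempty words contains a single letter only if all of them are letters
  that merge into one, with one \<open>q\<close> for each merger.\<close>

lemma lookup_stuffle_list_letter:
  assumes "[] \<notin> set us" "us \<noteq> []"
  shows "Poly_Mapping.lookup (stuffle_list q (map mon us)) [a] =
    (if (\<forall>u\<in>set us. length u = 1) \<and> weight (concat us) = index a then q ^ (length us - 1) else 0)"
  using assms
proof (induction us arbitrary: a)
  case (Cons u us)
  let ?P = "stuffle_list q (map mon us)"
  have lookup: "Poly_Mapping.lookup (stuffle_list q (map mon (u # us))) [a] =
    (\<Sum>v\<in>Poly_Mapping.keys ?P. Poly_Mapping.lookup ?P v * Poly_Mapping.lookup (stuffle_words q u v) [a])"
    by (simp add: stuffle_list_def stuffle_def keys_mon lookup_mon lookup_sum lookup_smult)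
  have u: "u \<noteq> []" using Cons.prems by auto
  show ?case
  proof (cases "us = []")
    case True
    have "length u = 1 \<and> weight u = index a \<longleftrightarrow> u = [a]"
      using index_inject by (auto simp: weight_def length_Suc_conv)
    then show ?thesis unfolding lookup using u
      by (simp add: True stuffle_list_def lookup_stuffle_words_letter flip: mon_Nil)
        (simp add: keys_mon lookup_mon)
  next
    case False
    then have us: "concat us \<noteq> []" using Cons.prems by (cases us) auto
    have Nil: "[] \<notin> Poly_Mapping.keys ?P"
      using keys_stuffle_list_mon[of q us] us by (auto simp: weight_eq_0[symmetric] weight_def)
    show ?thesis
    proof (cases "\<exists>b. u = [b] \<and> index b < index a")
      case True
      then obtain b where b: "u = [b]" "index b < index a" by blast
      let ?c = "y (index a - index b)"
      have c: "index b + index c = index a \<longleftrightarrow> c = ?c" for c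
        using y_eq_iff[of "index a - index b" c] b
        by (simp add: eq_commute[of c]) linarith
      then have ic: "index ?c = index a - index b" using b by (metis add_diff_cancel_left')
      have "Poly_Mapping.lookup (stuffle_list q (map mon (u # us))) [a] =
        (\<Sum>v\<in>Poly_Mapping.keys ?P. if v = [?c] then Poly_Mapping.lookup ?P v * q else 0)"
        unfolding lookup using Nil by (intro sum.cong) (auto simp: lookup_stuffle_words_letter b c)
      also have "\<dots> = Poly_Mapping.lookup ?P [?c] * q"
        by (simp add: in_keys_iff)
      also have "\<dots> = (if (\<forall>u\<in>set us. length u = 1) \<and> weight (concat us) = index ?c
        then q ^ (length us - 1) else 0) * q"
        using Cons False by simp
      also have "weight (concat us) = index ?c \<longleftrightarrow> weight (concat (u # us)) = index a"
        using b by (auto simp: ic weight_append) (auto simp: weight_def)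
      finally show ?thesis using False by (cases us) (auto simp: b mult.commute)
    next
      case no: False
      have "Poly_Mapping.lookup (stuffle_list q (map mon (u # us))) [a] = 0"
        unfolding lookup
      proof (rule sum.neutral, rule ballI)
        fix v assume "v \<in> Poly_Mapping.keys ?P"
        then have "v \<noteq> []" using Nil by auto
        moreover have "index b + index c \<noteq> index a" if "u = [b]" for b c
          using no that index_pos[of c] by auto
        ultimately show "Poly_Mapping.lookup ?P v * Poly_Mapping.lookup (stuffle_words q u v) [a] = 0"
          using u by (auto simp: lookup_stuffle_words_letter)
      qed
      moreover have "\<not> (length u = 1 \<and> weight (concat (u # us)) = index a)"
      proof
        assume *: "length u = 1 \<and> weight (concat (u # us)) = index a"
        then obtain b where b: "u = [b]" by (auto simp: length_Suc_conv)
        then have "index b + weight (concat us) = index a" using * by (simp add: weight_def)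
        moreover have "weight (concat us) \<noteq> 0" using us by (simp add: weight_eq_0)
        ultimately have "index b < index a" by linarith
        then show False using no b by blast
      qed
      ultimately show ?thesis by auto
    qed
  qed
qed simp

lemma smult_zero [simp]: "smult c 0 = 0"
  by (rule poly_mapping_eqI) (simp add: lookup_smult)

lemma lookup_Sum_any:
  assumes "finite {x. f x \<noteq> 0}"
  shows "Poly_Mapping.lookup (Sum_any f) w = Sum_any (\<lambda>x. Poly_Mapping.lookup (f x) w)"
proof -
  have "Sum_any (\<lambda>x. Poly_Mapping.lookup (f x) w) = (\<Sum>x\<in>{x. f x \<noteq> 0}. Poly_Mapping.lookup (f x) w)"
    using assms by (intro Sum_any.expand_superset) auto
  then show ?thesis by (simp add: Sum_any.expand_set lookup_sum)
qed

lemma concat_singletons: "(\<forall>u\<in>set us. length u = 1) \<Longrightarrow> concat us = w \<Longrightarrow> us = map (\<lambda>x. [x]) w"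
  by (induction us arbitrary: w) (auto simp: length_Suc_conv)

text \<open>Of all tuples with concatenation \<open>w\<close>, only the one cutting \<open>w\<close>
  into its letters contributes.\<close>

lemma lookup_pi1_summand_letter:
  assumes "2 \<le> k"
  shows "Poly_Mapping.lookup (Sum_any (pi1_summand q [a] k)) w =
    (if length w = k \<and> weight w = index a then q ^ (k - 1) else 0)"
proof -
  have "Poly_Mapping.lookup (pi1_summand q [a] k us) w =
    ((if length w = k \<and> weight w = index a then q ^ (k - 1) else 0) when us = map (\<lambda>x. [x]) w)" for us
  proof (cases "us \<in> tuples k")
    case True
    then have us: "length us = k" "[] \<notin> set us" "us \<noteq> []" using assms by (auto simp: tuples_def)
    have "us = map (\<lambda>x. [x]) w \<longleftrightarrow> (\<forall>u\<in>set us. length u = 1) \<and> concat us = w"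
      using concat_singletons[of us w] by auto
    then show ?thesis using us True
      by (auto simp: pi1_summand_def pairing_mon lookup_stuffle_list_letter prod_list_mon
          lookup_smult lookup_mon when_def)
  next
    case False
    then show ?thesis by (auto simp: pi1_summand_def tuples_def when_def)
  qed
  then show ?thesis by (simp add: lookup_Sum_any finite_support_pi1_summand)
qed

text \<open>This is the part of weight \<open>index a\<close> of
  \<open>(1/q) log (1 + q (y 1 + y 2 + ...))\<close>; the leading \<open>mon [a]\<close> supplies
  the term of length 1.\<close>

lemma lookup_pi1_letter:
  "Poly_Mapping.lookup (pi1 q [a]) w =
     (if weight w = index a then q ^ (length w - 1) * of_Q (log_coeff (length w)) else 0)"
proof -
  let ?f = "\<lambda>k. if 2 \<le> k then smult (of_Q ((-1) ^ (k - 1) / of_nat k)) (Sum_any (pi1_summand q [a] k)) else 0"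
  have "{k. ?f k \<noteq> 0} \<subseteq> {k. Sum_any (pi1_summand q [a] k) \<noteq> 0}" by auto
  then have "finite {k. ?f k \<noteq> 0}" using finite_support_pi1 by (rule finite_subset)
  then have "Poly_Mapping.lookup (pi1 q [a]) w =
    Poly_Mapping.lookup (mon [a]) w + (\<Sum>k. Poly_Mapping.lookup (?f k) w)"
    by (simp add: pi1_def lookup_add lookup_Sum_any)
  moreover have "Poly_Mapping.lookup (?f k) w = ((if 2 \<le> length w \<and> weight w = index a
    then q ^ (length w - 1) * of_Q (log_coeff (length w)) else 0) when k = length w)" for k
    by (auto simp: lookup_smult lookup_pi1_summand_letter when_def log_coeff_def mult.commute)
  moreover have "Poly_Mapping.lookup (mon [a]) w = (if length w = 1 \<and> weight w = index a then 1 else 0)"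
    using index_inject by (auto simp: lookup_mon weight_def length_Suc_conv)
  ultimately show ?thesis using weight_eq_0[of w] index_pos[of a]
    by (cases "length w" rule: nat.exhaust; cases "length w = 1") (auto simp: log_coeff_def of_Q_1)
qed

text \<open>On two nonempty words the coproduct must vanish. All words of their product have the
  same weight, so the weight condition in the coefficients either fails throughout or leaves the
  cancelling logarithmic sum.\<close>

lemma primitive_pi1_letter: "primitive q (pi1 q [a])"
proof -
  let ?P = "pi1 q [a]"
  have Nil: "Poly_Mapping.lookup ?P [] = 0"
    using index_pos[of a] by (simp add: lookup_pi1_letter weight_def)
  have "Poly_Mapping.lookup (coprod q ?P) (u, v) =
    Poly_Mapping.lookup (tensor_left ?P + tensor_right ?P) (u, v)" for u v
  proof -
    have "Poly_Mapping.lookup (tensor_left ?P + tensor_right ?P) (u, v) =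
      (if v = [] then Poly_Mapping.lookup ?P u else 0) + (if u = [] then Poly_Mapping.lookup ?P v else 0)"
      using lookup_tensor[of ?P 1 u v] lookup_tensor[of 1 ?P u v]
      by (simp add: lookup_add lookup_one when_def zero_list_def)
    moreover have "Poly_Mapping.lookup (coprod q ?P) (u, v) = 0" if "u \<noteq> []" "v \<noteq> []"
    proof -
      have "pairing (stuffle_words q u v) ?P = (if weight u + weight v = index a
        then evalf (\<lambda>w. q ^ (length w - 1) * of_Q (log_coeff (length w))) (stuffle_words q u v) else 0)"
        using keys_stuffle_words[of q u v]
        by (auto simp: pairing_def evalf_def lookup_pi1_letter intro!: sum.cong sum.neutral)
      then show ?thesis unfolding lookup_coprod evalf_log_stuffle_words[OF that] by simp
    qed
    ultimately show ?thesis using Nil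
      by (cases "u = []"; cases "v = []") (auto simp: lookup_coprod pairing_mon)
  qed
  then show ?thesis unfolding primitive_def by (intro poly_mapping_eqI) auto
qed

lemma primitive_Pi_lyndon: "l \<noteq> [] \<Longrightarrow> primitive q (Pi_lyndon q l)"
proof (induction "length l" arbitrary: l rule: less_induct)
  case less
  show ?case
  proof (cases "length l < 2")
    case True
    then obtain a where "l = [a]" using less.prems by (cases l) auto
    then show ?thesis by (simp add: Pi_lyndon.simps primitive_pi1_letter)
  next
    case False
    then have l: "2 \<le> length l" by simp
    obtain s r where sr: "standard_factorization l = (s, r)" by force
    have "s \<noteq> []" "r \<noteq> []"
      using is_standard_factorization[OF l]
      by (auto simp: sr is_standard_factorization_def lyndon_def)
    then have "primitive q (Pi_lyndon q s)" "primitive q (Pi_lyndon q r)"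
      using length_standard_factorization[OF l] by (auto simp: sr intro: less.hyps)
    then show ?thesis using False
      by (subst Pi_lyndon.simps) (simp add: sr Let_def primitive_commutator)
  qed
qed

section \<open>The dual basis\<close>

text \<open>Fixing the weight leaves finitely many words to compare. Length comes first because
  lexicographic comparison respects concatenation on the right only if no word is a proper prefix of
  the other.\<close>

definition above :: "word \<Rightarrow> word set" where
  "above w = {x. weight x = weight w \<and> (length w < length x \<or> length w = length x \<and> w < x)}"

definition unitriangular :: "word \<Rightarrow> 'k::comm_ring_1 ncpoly \<Rightarrow> bool" where
  "unitriangular w P \<longleftrightarrow> Poly_Mapping.keys (P - mon w) \<subseteq> above w"

lemma append_above:
  assumes "x \<in> insert u (above u)" "z \<in> insert v (above v)" "x \<noteq> u \<or> z \<noteq> v"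
  shows "x @ z \<in> above (u @ v)"
proof (cases "length x = length u \<and> length z = length v")
  case True
  then have "u \<le> x" "v \<le> z" using assms by (auto simp: above_def)
  then have "u @ v \<le> x @ z" using True by (intro append_le_append) auto
  moreover have "u @ v \<noteq> x @ z" using True assms by auto
  ultimately have "u @ v < x @ z" by simp
  then show ?thesis using True assms by (auto simp: above_def weight_append)
qed (use assms in \<open>auto simp: above_def weight_append\<close>)

lemma keys_mult_subset:
  assumes "Poly_Mapping.keys P \<subseteq> X" "Poly_Mapping.keys R \<subseteq> Z" "\<And>x z. x \<in> X \<Longrightarrow> z \<in> Z \<Longrightarrow> x @ z \<in> A"
  shows "Poly_Mapping.keys (P * R) \<subseteq> A"
  using keys_mult[of P R] assms unfolding plus_list_def by blast

lemma not_in_above: "w \<notin> above w"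
  by (simp add: above_def)

lemma unitriangular_keys:
  assumes "unitriangular w P"
  shows "Poly_Mapping.keys P \<subseteq> insert w (above w)"
  using assms keys_add[of "P - mon w" "mon w"] by (auto simp: unitriangular_def keys_mon)

lemma unitriangular_lookup:
  assumes "unitriangular w P"
  shows "Poly_Mapping.lookup P w = 1"
proof -
  have "Poly_Mapping.lookup (P - mon w) w = 0"
    using assms not_in_above[of w] not_in_keys_iff_lookup_eq_zero[of w "P - mon w"]
    by (auto simp: unitriangular_def)
  then show ?thesis by (simp add: lookup_minus lookup_mon)
qed

lemma unitriangular_one: "unitriangular [] 1"
  by (simp add: unitriangular_def mon_Nil)

lemma unitriangular_mult:
  assumes "unitriangular u P" "unitriangular v R"
  shows "unitriangular (u @ v) (P * R)"
proof -
  have "P * R - mon (u @ v) = mon u * (R - mon v) + (P - mon u) * R"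
    by (simp add: mon_append algebra_simps)
  moreover have "Poly_Mapping.keys (mon u * (R - mon v)) \<subseteq> above (u @ v)"
    using assms not_in_above
    by (intro keys_mult_subset[of _ "{u}" _ "above v"] append_above)
      (auto simp: unitriangular_def keys_mon)
  moreover have "Poly_Mapping.keys ((P - mon u) * R) \<subseteq> above (u @ v)"
    using assms unitriangular_keys[OF assms(2)] not_in_above
    by (intro keys_mult_subset[of _ "above u" _ "insert v (above v)"] append_above)
      (auto simp: unitriangular_def)
  ultimately show ?thesis unfolding unitriangular_def
    using keys_add[of "mon u * (R - mon v)" "(P - mon u) * R"] by auto
qed

text \<open>The leading word \<open>r @ s\<close> of \<open>R * P\<close> has the weight and length
  of \<open>s @ r\<close> and is larger, so the subtracted product does not disturb the leading
  term.\<close>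

lemma unitriangular_commutator:
  assumes "unitriangular s P" "unitriangular r R" "s @ r < r @ s"
  shows "unitriangular (s @ r) (P * R - R * P)"
proof -
  have "insert (r @ s) (above (r @ s)) \<subseteq> above (s @ r)"
    using assms(3) by (auto simp: above_def weight_append)
  then have "Poly_Mapping.keys (R * P) \<subseteq> above (s @ r)"
    using unitriangular_keys[OF unitriangular_mult[OF assms(2,1)]] by blast
  moreover have "Poly_Mapping.keys (P * R - mon (s @ r)) \<subseteq> above (s @ r)"
    using unitriangular_mult[OF assms(1,2)] by (simp add: unitriangular_def)
  ultimately have "Poly_Mapping.keys ((P * R - mon (s @ r)) - R * P) \<subseteq> above (s @ r)"
    using keys_diff[of "P * R - mon (s @ r)" "R * P"] by blast
  then show ?thesis by (simp add: unitriangular_def algebra_simps)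
qed

lemma unitriangular_pi1_letter: "unitriangular [a] (pi1 q [a])"
  unfolding unitriangular_def
proof
  fix w assume w: "w \<in> Poly_Mapping.keys (pi1 q [a] - mon [a])"
  then have *: "weight w = index a" "w \<noteq> [a]"
    by (auto simp: in_keys_iff lookup_minus lookup_pi1_letter lookup_mon weight_def log_coeff_def of_Q_1
        split: if_splits)
  then have "length w \<noteq> 1" using index_inject by (auto simp: length_Suc_conv weight_def)
  moreover have "w \<noteq> []" using *(1) index_pos[of a] by (auto simp: weight_def)
  ultimately have "1 < length w" by (cases w) auto
  then show "w \<in> above [a]" using * by (simp add: above_def) (simp add: weight_def)
qed

lemma unitriangular_Pi_lyndon: "lyndon l \<Longrightarrow> unitriangular l (Pi_lyndon q l)"
proof (induction "length l" arbitrary: l rule: less_induct)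
  case less
  show ?case
  proof (cases "length l < 2")
    case True
    moreover have "l \<noteq> []" using less.prems by (simp add: lyndon_def)
    ultimately obtain a where "l = [a]" by (cases l) auto
    then show ?thesis by (simp add: Pi_lyndon.simps unitriangular_pi1_letter)
  next
    case False
    then have l: "2 \<le> length l" by simp
    obtain s r where sr: "standard_factorization l = (s, r)" by force
    note lyn = standard_factorization_lyndon[OF l less.prems sr]
    have "length s < length l" "length r < length l"
      using length_standard_factorization[OF l] by (simp_all add: sr)
    then have "unitriangular s (Pi_lyndon q s)" "unitriangular r (Pi_lyndon q r)"
      using lyn less.hyps by blast+
    moreover have "s @ r < r @ s"
    proof -
      have "l < r" using lyndonD[OF less.prems lyn(1)] lyn by (simp add: lyndon_def)
      also have "r \<le> r @ s" by (rule le_append)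
      finally show ?thesis using lyn(1) by simp
    qed
    ultimately have "unitriangular (s @ r) (Pi_lyndon q s * Pi_lyndon q r - Pi_lyndon q r * Pi_lyndon q s)"
      by (rule unitriangular_commutator)
    moreover have "Pi_lyndon q l = Pi_lyndon q s * Pi_lyndon q r - Pi_lyndon q r * Pi_lyndon q s"
      using False by (subst Pi_lyndon.simps) (simp add: sr Let_def)
    ultimately show ?thesis using lyn(1) by simp
  qed
qed

lemma unitriangular_Pi_word: "unitriangular w (Pi_word q w)"
proof -
  obtain ms where ms: "lyndon_list ms" "concat ms = w" using lyndon_list_exists by blast
  have "\<forall>m\<in>set ms. lyndon m \<Longrightarrow> unitriangular (concat ms) (prod_list (map (Pi_lyndon q) ms))"
    by (induction ms) (auto simp: unitriangular_one unitriangular_Pi_lyndon intro: unitriangular_mult)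
  then show ?thesis using Pi_word_concat[OF ms(1), of q] ms by (simp add: lyndon_list_def)
qed

section \<open>Existence and uniqueness of the dual family\<close>

text \<open>Let \<open>w\<close> be the lexicographically largest among the longest words of
  \<open>D\<close>. Nothing in \<open>D\<close> lies above \<open>w\<close>, so pairing
  \<open>D\<close> with \<open>Pi_word q w\<close> returns just the coefficient of
  \<open>w\<close>.\<close>

lemma Pi_word_separates:
  assumes "\<And>u. pairing D (Pi_word q u) = 0"
  shows "D = 0"
proof (rule ccontr)
  assume "D \<noteq> 0"
  then have ne: "Poly_Mapping.keys D \<noteq> {}" by simp
  define n where "n = Max (length ` Poly_Mapping.keys D)"
  define K where "K = {w \<in> Poly_Mapping.keys D. length w = n}"
  have "n \<in> length ` Poly_Mapping.keys D" unfolding n_def using ne by (intro Max_in) auto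
  then have K: "K \<noteq> {}" "finite K" by (auto simp: K_def)
  define w where "w = Max K"
  have w: "w \<in> K" using Max_in[OF K(2,1)] by (simp add: w_def)
  have "x \<notin> above w" if "x \<in> Poly_Mapping.keys D" for x
  proof
    assume x: "x \<in> above w"
    have "length x \<le> n" unfolding n_def using that by simp
    then have "x \<in> K" "w < x" using x w that by (auto simp: above_def K_def)
    then show False using Max_ge[OF K(2), of x] by (simp add: w_def leD)
  qed
  then have "Poly_Mapping.lookup (Pi_word q w) x = 0" if "x \<in> Poly_Mapping.keys D" "x \<noteq> w" for x
    using unitriangular_keys[OF unitriangular_Pi_word[of w q]] that by (auto simp: in_keys_iff subset_iff)
  then have "pairing D (Pi_word q w) =
    (\<Sum>x\<in>Poly_Mapping.keys D. if x = w then Poly_Mapping.lookup D w else 0)"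
    unfolding pairing_def
    by (intro sum.cong) (auto simp: unitriangular_lookup[OF unitriangular_Pi_word])
  then have "Poly_Mapping.lookup D w = 0" using assms w by (simp add: K_def)
  then show False using w by (simp add: K_def in_keys_iff)
qed

text \<open>A unitriangular system is inverted by recursion. The word \<open>v\<close> itself pairs
  to 1 with \<open>Pi_word q v\<close>, and its unwanted pairings occur only at the finitely many
  \<open>u\<close> with \<open>v\<close> in \<open>above u\<close>; subtracting multiples of their
  dual elements removes them.\<close>

lemma dual_element_exists: "\<exists>S. \<forall>u. pairing S (Pi_word q u) = (if u = v then 1 else 0)"
proof (induction "card {u. v \<in> above u}" arbitrary: v rule: less_induct)
  case less
  have fin: "finite {u. v \<in> above u}" for v
    by (rule finite_subset[OF _ finite_words[of "weight v"]]) (auto simp: above_def)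
  have "\<exists>S. \<forall>x. pairing S (Pi_word q x) = (if x = u then 1 else 0)" if "v \<in> above u" for u
  proof (rule less.hyps, rule psubset_card_mono[OF fin])
    have "{x. u \<in> above x} \<subseteq> {x. v \<in> above x}" using that by (auto simp: above_def)
    then show "{x. u \<in> above x} \<subset> {x. v \<in> above x}" using that not_in_above[of u] by blast
  qed
  then obtain S where S: "pairing (S u) (Pi_word q x) = (if x = u then 1 else 0)" if "v \<in> above u" for u x
    by metis
  define T where "T = mon v - (\<Sum>u\<in>{u. v \<in> above u}. smult (Poly_Mapping.lookup (Pi_word q u) v) (S u))"
  have "pairing T (Pi_word q x) = (if x = v then 1 else 0)" for x
  proof -
    have "pairing T (Pi_word q x) = Poly_Mapping.lookup (Pi_word q x) v -
      (\<Sum>u\<in>{u. v \<in> above u}. if u = x then Poly_Mapping.lookup (Pi_word q x) v else 0)"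
      unfolding T_def pairing_diff_left pairing_sum_left pairing_mon
      by (intro arg_cong2[of _ _ _ _ minus] sum.cong) (auto simp: pairing_smult_left S)
    also have "\<dots> = (if v \<in> above x then 0 else Poly_Mapping.lookup (Pi_word q x) v)"
      using fin by simp
    also have "\<dots> = (if x = v then 1 else 0)"
      using unitriangular_keys[OF unitriangular_Pi_word[of x q]] not_in_above[of x]
        unitriangular_lookup[OF unitriangular_Pi_word[of v q]]
      by (auto simp: in_keys_iff subset_iff)
    finally show ?thesis .
  qed
  then show ?case by blast
qed

lemma pairing_Sigma_word: "pairing (Sigma_word q v) (Pi_word q u) = (if u = v then 1 else 0)"
proof -
  have "\<exists>!S. \<forall>u. pairing S (Pi_word q u) = (if u = v then 1 else 0)"
  proof (rule ex_ex1I[OF dual_element_exists])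
    fix S T
    assume "\<forall>u. pairing S (Pi_word q u) = (if u = v then 1 else 0)"
      "\<forall>u. pairing T (Pi_word q u) = (if u = v then 1 else 0)"
    then have "S - T = 0" by (intro Pi_word_separates[of _ q]) (simp add: pairing_diff_left)
    then show "S = T" by simp
  qed
  from theI'[OF this] show ?thesis by (simp add: Sigma_word_def)
qed

lemma eq_smult_Sigma_wordI:
  assumes "\<And>u. pairing S (Pi_word q u) = (if u = v then c else 0)"
  shows "S = smult c (Sigma_word q v)"
proof -
  have "S - smult c (Sigma_word q v) = 0"
    by (rule Pi_word_separates[of _ q])
      (simp add: pairing_diff_left pairing_smult_left pairing_Sigma_word assms)
  then show ?thesis by simp
qed

section \<open>Stuffle products of dual elements\<close>

lemma smult_1 [simp]: "smult 1 P = P"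
  by (rule poly_mapping_eqI) (simp add: lookup_smult)

lemma smult_smult [simp]: "smult c (smult d P) = smult (c * d) P"
  by (rule poly_mapping_eqI) (simp add: lookup_smult mult.assoc)

lemma smult_sum: "smult c (\<Sum>i\<in>A. f i) = (\<Sum>i\<in>A. smult c (f i))"
  by (rule poly_mapping_eqI) (simp add: lookup_smult lookup_sum sum_distrib_left)

lemma stuffle_superset:
  assumes "finite A" "Poly_Mapping.keys P \<subseteq> A" "finite B" "Poly_Mapping.keys R \<subseteq> B"
  shows "stuffle q P R = (\<Sum>u\<in>A. \<Sum>v\<in>B.
     smult (Poly_Mapping.lookup P u * Poly_Mapping.lookup R v) (stuffle_words q u v))"
proof -
  have "stuffle q P R = (\<Sum>u\<in>Poly_Mapping.keys P. \<Sum>v\<in>B.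
     smult (Poly_Mapping.lookup P u * Poly_Mapping.lookup R v) (stuffle_words q u v))"
    unfolding stuffle_def
    by (intro sum.cong refl sum_keys_superset[OF assms(3,4),
        where g = "\<lambda>v d. smult (Poly_Mapping.lookup P u * d) (stuffle_words q u v)" for u])
      (simp add: smult_0)
  also have "\<dots> = (\<Sum>u\<in>A. \<Sum>v\<in>B.
     smult (Poly_Mapping.lookup P u * Poly_Mapping.lookup R v) (stuffle_words q u v))"
    by (rule sum_keys_superset[OF assms(1,2),
        where g = "\<lambda>u c. \<Sum>v\<in>B. smult (c * Poly_Mapping.lookup R v) (stuffle_words q u v)"])
      (simp add: smult_0)
  finally show ?thesis .
qed

lemma stuffle_smult: "stuffle q (smult c P) (smult d R) = smult (c * d) (stuffle q P R)"
  unfolding stuffle_superset[OF finite_keys keys_smult finite_keys keys_smult]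
  by (simp add: stuffle_def smult_sum lookup_smult mult_ac)

text \<open>Serves two purposes: if \<open>ns\<close> consists of copies of \<open>l\<close>, the
  binomial coefficients build up the factorial; if \<open>l\<close> does not occur in
  \<open>ns\<close>, the coefficient is 1.\<close>

lemma stuffle_Sigma_word:
  assumes "lyndon l" "lyndon_list ns" "\<forall>n\<in>set ns. n \<le> l"
  shows "stuffle q (Sigma_word q (concat (replicate i l))) (Sigma_word q (concat ns)) =
    smult (of_nat ((i + count_list ns l) choose i)) (Sigma_word q (concat (replicate i l @ ns)))"
proof (rule eq_smult_Sigma_wordI)
  fix x
  obtain ms where ms: "lyndon_list ms" "x = concat ms" using lyndon_list_exists[of x] by auto
  have ll: "lyndon_list (replicate i l)"
    using assms(1) by (auto simp: lyndon_list_def sorted_wrt_iff_nth_less)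
  have app: "lyndon_list (replicate i l @ ns)"
    using ll assms by (auto simp: lyndon_list_def sorted_wrt_append)
  have "primitive q (Pi_lyndon q m)" if "m \<in> set ms" for m
    using ms that by (intro primitive_Pi_lyndon) (auto simp: lyndon_list_def lyndon_def)
  then have "pairing (stuffle q (Sigma_word q (concat (replicate i l))) (Sigma_word q (concat ns))) (Pi_word q x) =
    (\<Sum>(u, v)\<leftarrow>splits ms. pairing (Sigma_word q (concat (replicate i l))) (prod_list (map (Pi_lyndon q) u))
      * pairing (Sigma_word q (concat ns)) (prod_list (map (Pi_lyndon q) v)))"
    unfolding ms(2) Pi_word_concat[OF ms(1)] by (rule pairing_stuffle_prod_list)
  also have "\<dots> = (\<Sum>p\<leftarrow>splits ms. if p = (replicate i l, ns) then 1 else 0)"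
  proof (rule arg_cong[of _ _ sum_list], rule map_cong[OF refl])
    fix p assume p: "p \<in> set (splits ms)"
    obtain u v where uv: "p = (u, v)" by force
    have "lyndon_list u" "lyndon_list v"
      using ms(1) splits_sorted[of u v ms] p by (auto simp: lyndon_list_def uv)
    then have "concat u = concat (replicate i l) \<longleftrightarrow> u = replicate i l" "concat v = concat ns \<longleftrightarrow> v = ns"
      using lyndon_list_unique[of u "replicate i l"] lyndon_list_unique[of v ns] ll assms(2) by auto
    moreover have "prod_list (map (Pi_lyndon q) u) = Pi_word q (concat u)"
        "prod_list (map (Pi_lyndon q) v) = Pi_word q (concat v)"
      using Pi_word_concat[OF \<open>lyndon_list u\<close>, of q] Pi_word_concat[OF \<open>lyndon_list v\<close>, of q] by simp_all
    ultimately show "(case p of (u, v) \<Rightarrow>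
        pairing (Sigma_word q (concat (replicate i l))) (prod_list (map (Pi_lyndon q) u))
        * pairing (Sigma_word q (concat ns)) (prod_list (map (Pi_lyndon q) v))) =
      (if p = (replicate i l, ns) then 1 else 0)"
      by (simp add: uv pairing_Sigma_word)
  qed
  also have "\<dots> = of_nat (count_list (splits ms) (replicate i l, ns))"
  proof -
    have "(\<Sum>p\<leftarrow>xs. if p = z then 1 else 0) = (of_nat (count_list xs z) :: 'a)" for xs and z :: "'x"
      by (induction xs) auto
    then show ?thesis .
  qed
  finally have pairing: "pairing (stuffle q (Sigma_word q (concat (replicate i l))) (Sigma_word q (concat ns))) (Pi_word q x) =
    of_nat (count_list (splits ms) (replicate i l, ns))" .
  have "count_list (splits ms) (replicate i l, ns) =
    (if ms = replicate i l @ ns then (i + count_list ns l) choose i else 0)"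
    using ms assms by (intro count_list_splits_replicate) (auto simp: lyndon_list_def)
  moreover have "ms = replicate i l @ ns \<longleftrightarrow> x = concat (replicate i l @ ns)"
    using lyndon_list_unique[OF ms(1) app] ms(2) by auto
  ultimately show "pairing (stuffle q (Sigma_word q (concat (replicate i l))) (Sigma_word q (concat ns))) (Pi_word q x) =
    (if x = concat (replicate i l @ ns) then of_nat ((i + count_list ns l) choose i) else 0)"
    unfolding pairing by simp
qed

lemma Sigma_word_Nil: "Sigma_word q [] = 1"
proof -
  have "pairing 1 (Pi_word q u) = (if u = [] then 1 else 0)" for u
    using unitriangular_keys[OF unitriangular_Pi_word[of u q]]
      unitriangular_lookup[OF unitriangular_Pi_word[of "[]" q]]
    by (auto simp: pairing_mon above_def in_keys_iff subset_iff simp flip: mon_Nil)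
  from eq_smult_Sigma_wordI[OF this] show ?thesis by simp
qed

text \<open>A letter lies above no word: a shorter word is empty and has weight 0, and another
  letter has another weight.\<close>

lemma Sigma_word_letter: "Sigma_word q [a] = mon [a]"
proof -
  have "pairing (mon [a]) (Pi_word q u) = (if u = [a] then 1 else 0)" for u
  proof (cases "u = [a]")
    case True
    then show ?thesis
      by (simp add: pairing_mon unitriangular_lookup[OF unitriangular_Pi_word])
  next
    case False
    have "[a] \<notin> above u"
    proof
      assume "[a] \<in> above u"
      then have "u = [] \<or> (\<exists>b. u = [b] \<and> index b = index a \<and> b \<noteq> a)" "weight u = index a"
        by (auto simp: above_def weight_def less_Suc_eq length_Suc_conv)
      then show False using index_pos[of a] index_inject by (auto simp: weight_def)
    qed
    then show ?thesis
      using unitriangular_keys[OF unitriangular_Pi_word[of u q]] False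
      by (auto simp: pairing_mon in_keys_iff subset_iff)
  qed
  from eq_smult_Sigma_wordI[OF this] show ?thesis by simp
qed

lemma check_pi1_letter: "check_pi1 q [a] = mon [a]"
proof -
  have "check_pi1_summand q [a] k = (\<lambda>us. 0)" if "2 \<le> k" for k
  proof (rule ext, rule ccontr)
    fix us assume "check_pi1_summand q [a] k us \<noteq> 0"
    note us = check_pi1_summand_nonzero[OF this]
    then show False using length_le_concat[of us] that by (simp add: tuples_def)
  qed
  then have eq: "(\<lambda>k. if 2 \<le> k then smult (of_Q ((-1) ^ (k - 1) / of_nat k))
    (Sum_any (check_pi1_summand q [a] k)) else 0) = (\<lambda>k. 0)"
    by auto
  show ?thesis unfolding check_pi1_def eq by simp
qed

lemma stuffle_pow_Sigma_word:
  assumes "lyndon l"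
  shows "stuffle_pow q (Sigma_word q l) i = smult (of_nat (fact i)) (Sigma_word q (concat (replicate i l)))"
proof (induction i)
  case 0
  show ?case by (simp add: stuffle_pow_def Sigma_word_Nil)
next
  case (Suc i)
  have ll: "lyndon_list (replicate i l)"
    using assms by (auto simp: lyndon_list_def sorted_wrt_iff_nth_less)
  have count: "count_list (replicate i l) l = i" by (induction i) auto
  have "stuffle q (Sigma_word q l) (Sigma_word q (concat (replicate i l))) =
    smult (of_nat (Suc i)) (Sigma_word q (concat (replicate (Suc i) l)))"
    \<comment> \<open>The new factor is a first power, so the binomial coefficient is
      \<open>(1 + i) choose 1\<close>.\<close>
    using stuffle_Sigma_word[OF assms ll, of q 1] by (simp add: count)
  moreover have "stuffle_pow q (Sigma_word q l) (Suc i) =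
    stuffle q (smult 1 (Sigma_word q l)) (stuffle_pow q (Sigma_word q l) i)"
    by (simp add: stuffle_pow_def)
  ultimately show ?case
    unfolding Suc stuffle_smult by (simp add: algebra_simps)
qed

lemma stuffle_list_Sigma_word:
  assumes "is_lyndon_factorization w fs"
  shows "stuffle_list q (map (\<lambda>(l, i). stuffle_pow q (Sigma_word q l) i) fs) =
    smult (of_Q (\<Prod>(l, i)\<leftarrow>fs. fact i)) (Sigma_word q w)"
  using assms
proof (induction fs arbitrary: w)
  case Nil
  then show ?case by (simp add: stuffle_list_def Sigma_word_Nil of_Q_1)
next
  case (Cons f fs)
  obtain l i where f: "f = (l, i)" by force
  obtain v where v: "is_lyndon_factorization v fs" "w = concat (replicate i l) @ v"
    and l: "lyndon l" "\<forall>x \<in> fst ` set fs. x < l"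
    using Cons.prems by (auto simp: f is_lyndon_factorization_Cons)
  have set: "set (expand fs) = fst ` set fs"
    using v by (intro set_expand) (auto simp: is_lyndon_factorization_def)
  \<comment> \<open>Different bases do not interact: the binomial coefficient for the next product
    becomes 1.\<close>
  have count: "count_list (expand fs) l = 0" using l(2) by (auto simp: set count_list_0_iff)
  have "\<forall>x\<in>set (expand fs). x \<le> l" using l(2) by (auto simp: set)
  note mult = stuffle_Sigma_word[OF l(1) lyndon_list_expand(1)[OF v(1)] this, of q i]
  have "stuffle_list q (map (\<lambda>(l, i). stuffle_pow q (Sigma_word q l) i) (f # fs)) =
    stuffle q (smult (of_nat (fact i)) (Sigma_word q (concat (replicate i l))))
      (smult (of_Q (\<Prod>(l, i)\<leftarrow>fs. fact i)) (Sigma_word q v))"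
    using Cons.IH[OF v(1)] stuffle_pow_Sigma_word[OF l(1), of q i] by (simp add: f stuffle_list_def)
  also have "\<dots> = smult (of_nat (fact i) * of_Q (\<Prod>(l, i)\<leftarrow>fs. fact i)) (Sigma_word q w)"
    using mult by (simp add: stuffle_smult count lyndon_list_expand[OF v(1)] v(2))
  also have "of_nat (fact i) * of_Q (\<Prod>(l, i)\<leftarrow>fs. fact i) = (of_Q (\<Prod>(l, i)\<leftarrow>f # fs. fact i) :: 'a)"
    using of_Q_of_nat[of "fact i", where 'a = 'a] by (simp add: f of_Q_mult)
  finally show ?case .
qed

theorem proposition4:
  fixes q :: "'k::comm_rat_algebra_1"
  shows "Sigma_word q [] = 1
    \<and> (\<forall>w fs. is_lyndon_factorization w fs \<longrightarrow>
         Sigma_word q w =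
           smult (of_Q (1 / (\<Prod>(l, i)\<leftarrow>fs. fact i)))
             (stuffle_list q (map (\<lambda>(l, i). stuffle_pow q (Sigma_word q l) i) fs)))
    \<and> (\<forall>a. Sigma_word q [a] = mon [a] \<and> mon [a] = check_pi1 q [a])"
proof (intro conjI allI impI)
  fix w fs assume "is_lyndon_factorization w fs"
  \<comment> \<open>The factorials are inverted among the rationals, before \<open>of_Q\<close> maps
    them to the algebra.\<close>
  moreover have "(\<Prod>(l, i)\<leftarrow>gs. fact i :: rat) \<noteq> 0" for gs :: "(word \<times> nat) list"
    by (induction gs) auto
  ultimately show "Sigma_word q w = smult (of_Q (1 / (\<Prod>(l, i)\<leftarrow>fs. fact i)))
      (stuffle_list q (map (\<lambda>(l, i). stuffle_pow q (Sigma_word q l) i) fs))"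
    by (simp add: stuffle_list_Sigma_word of_Q_1 flip: of_Q_mult)
qed (simp_all add: Sigma_word_Nil Sigma_word_letter check_pi1_letter)

end
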